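(* Up to isomorphism there are exactly two $2$-integral probability groups with $3$ elements, namely $A(\Bbbk\mathcal{S}_3)$ and $A(\Bbbk\mathbb{Z}_3)$.
   Context: $\Bbbk$ is an algebraically closed field of characteristic zero; $\mathcal{S}_3$ is the symmetric group on three letters. A probability group is a set $A$ with a map $(a,b,c)\mapsto p(a\cdot b=c)$ from $A\times A\times A$ to $\mathbb{R}_{\ge0}$ (the probability map) such that: (1) for all $a,b$, $p(a\cdot b=c)=0$ for all but finitely many $c$, and $\sum_{c}p(a\cdot b=c)=1$; (2) for all $a,b,c,d$, $\sum_{x}p(a\cdot b=x)p(x\cdot c=d)=\sum_{y}p(a\cdot y=d)p(b\cdot c=y)$; (3) there is $1\in A$ with $p(1\cdot a=a)=1=p(a\cdot1=a)$ for all $a$; (4) for each $a$ there is a unique $a^{-1}\in A$ with $p(a\cdot a^{-1}=1)>0$; (5) $p(a\cdot b=c)=p(b^{-1}\cdot a^{-1}=c^{-1})$ for all $a,b,c$; (6) $p(a\cdot a^{-1}=1)=p(a^{-1}\cdot a=1)$ for all $a$. The size of $a$ is $s(a)=1/p(a\cdot a^{-1}=1)$. For a positive integer $r$, $A$ is $r$-integral if $s(a)^{1/r}$ is an integer for all $a\in A$, and $p(a\cdot b=c)\,s(a)^{1/r}s(b)^{1/r}/s(c)^{1/r}$ is a non-negative integer for all $a,b,c\in A$. An isomorphism of probability groups is a bijection preserving the probability maps. For a finite group $G$ with irreducible $\Bbbk$-characters $\chi_1,\dots,\chi_m$ and $\chi_i\chi_j=\sum_kN_{ij}^k\chi_k$,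 $A(\Bbbk G)=\{\chi_1,\dots,\chi_m\}$ is the probability group with $p(\chi_i\cdot\chi_j=\chi_k)=\frac{N_{ij}^k\chi_k(1)}{\chi_i(1)\chi_j(1)}$. *)

theory Defs
  imports
    "HOL-Algebra.Sym_Groups"
    "HOL-Algebra.Elementary_Groups"
    "HOL-Computational_Algebra.Polynomial"
    "HOL-Library.FuncSet"
    "Jordan_Normal_Form.VS_Connect"
begin

section \<open>Probability groups\<close>

text \<open>
  A probability map on a set \<open>A\<close> is a function \<open>p\<close>, where \<open>p a b c\<close> stands for
  \<open>p(a \<cdot> b = c)\<close>; only its values at arguments from \<open>A\<close> matter. As \<open>A\<close> may be infinite,
  the sums below range over the finite support of \<open>p a b\<close>, because \<open>sum\<close> over an infinite
  set is \<open>0\<close> by convention.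
\<close>

definition pg_supp :: "'a set \<Rightarrow> ('a \<Rightarrow> 'a \<Rightarrow> 'a \<Rightarrow> real) \<Rightarrow> 'a \<Rightarrow> 'a \<Rightarrow> 'a set" where
  "pg_supp A p a b = {c \<in> A. p a b c \<noteq> 0}"

definition is_pg_one :: "'a set \<Rightarrow> ('a \<Rightarrow> 'a \<Rightarrow> 'a \<Rightarrow> real) \<Rightarrow> 'a \<Rightarrow> bool" where
  "is_pg_one A p e \<longleftrightarrow> e \<in> A \<and> (\<forall>a\<in>A. p e a a = 1 \<and> p a e a = 1)"

text \<open>
  The identity is unique as soon as the values of \<open>p a b\<close> are non-negative with sum \<open>1\<close>:
  two identities \<open>e\<close>, \<open>f\<close> satisfy \<open>p e f f = 1\<close> and \<open>p e f e = 1\<close>.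
  Uniqueness of inverses is an axiom of probability groups.
\<close>

definition pg_one :: "'a set \<Rightarrow> ('a \<Rightarrow> 'a \<Rightarrow> 'a \<Rightarrow> real) \<Rightarrow> 'a" where
  "pg_one A p = (THE e. is_pg_one A p e)"

definition pg_inv :: "'a set \<Rightarrow> ('a \<Rightarrow> 'a \<Rightarrow> 'a \<Rightarrow> real) \<Rightarrow> 'a \<Rightarrow> 'a" where
  "pg_inv A p a = (THE b. b \<in> A \<and> p a b (pg_one A p) > 0)"

locale prob_group =
  fixes A :: "'a set" and p :: "'a \<Rightarrow> 'a \<Rightarrow> 'a \<Rightarrow> real"
  assumes nonneg: "\<lbrakk>a \<in> A; b \<in> A; c \<in> A\<rbrakk> \<Longrightarrow> p a b c \<ge> 0"
    and finite_supp: "\<lbrakk>a \<in> A; b \<in> A\<rbrakk> \<Longrightarrow> finite (pg_supp A p a b)"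
    and sum_one: "\<lbrakk>a \<in> A; b \<in> A\<rbrakk> \<Longrightarrow> (\<Sum>c \<in> pg_supp A p a b. p a b c) = 1"
    and assoc: "\<lbrakk>a \<in> A; b \<in> A; c \<in> A; d \<in> A\<rbrakk> \<Longrightarrow>
      (\<Sum>x \<in> pg_supp A p a b. p a b x * p x c d) = (\<Sum>y \<in> pg_supp A p b c. p a y d * p b c y)"
    and ex_one: "\<exists>e. is_pg_one A p e"
    and ex1_inv: "a \<in> A \<Longrightarrow> \<exists>!b. b \<in> A \<and> p a b (pg_one A p) > 0"
    and inv_swap: "\<lbrakk>a \<in> A; b \<in> A; c \<in> A\<rbrakk> \<Longrightarrow>
      p a b c = p (pg_inv A p b) (pg_inv A p a) (pg_inv A p c)"
    and inv_comm: "a \<in> A \<Longrightarrow>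
      p a (pg_inv A p a) (pg_one A p) = p (pg_inv A p a) a (pg_one A p)"

definition pg_size :: "'a set \<Rightarrow> ('a \<Rightarrow> 'a \<Rightarrow> 'a \<Rightarrow> real) \<Rightarrow> 'a \<Rightarrow> real" where
  "pg_size A p a = 1 / p a (pg_inv A p a) (pg_one A p)"

definition pg_integral :: "nat \<Rightarrow> 'a set \<Rightarrow> ('a \<Rightarrow> 'a \<Rightarrow> 'a \<Rightarrow> real) \<Rightarrow> bool" where
  "pg_integral r A p \<longleftrightarrow> r > 0 \<and>
     (\<forall>a\<in>A. root r (pg_size A p a) \<in> \<int>) \<and>
     (\<forall>a\<in>A. \<forall>b\<in>A. \<forall>c\<in>A.
        p a b c * root r (pg_size A p a) * root r (pg_size A p b) / root r (pg_size A p c) \<in> \<nat>)"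

definition pg_isomorphic ::
    "'a set \<Rightarrow> ('a \<Rightarrow> 'a \<Rightarrow> 'a \<Rightarrow> real) \<Rightarrow> 'b set \<Rightarrow> ('b \<Rightarrow> 'b \<Rightarrow> 'b \<Rightarrow> real) \<Rightarrow> bool" where
  "pg_isomorphic A p B q \<longleftrightarrow>
     (\<exists>f. bij_betw f A B \<and> (\<forall>a\<in>A. \<forall>b\<in>A. \<forall>c\<in>A. q (f a) (f b) (f c) = p a b c))"


section \<open>Irreducible characters of a finite group\<close>

definition matrix_rep :: "('g, 'm) monoid_scheme \<Rightarrow> nat \<Rightarrow> ('g \<Rightarrow> 'k::field mat) \<Rightarrow> bool" where
  "matrix_rep G n \<rho> \<longleftrightarrow>
     (\<forall>g \<in> carrier G. \<rho> g \<in> carrier_mat n n) \<and>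
     \<rho> \<one>\<^bsub>G\<^esub> = 1\<^sub>m n \<and>
     (\<forall>g \<in> carrier G. \<forall>h \<in> carrier G. \<rho> (g \<otimes>\<^bsub>G\<^esub> h) = \<rho> g * \<rho> h)"

definition irreducible_rep :: "('g, 'm) monoid_scheme \<Rightarrow> nat \<Rightarrow> ('g \<Rightarrow> 'k::field mat) \<Rightarrow> bool" where
  "irreducible_rep G n \<rho> \<longleftrightarrow> matrix_rep G n \<rho> \<and> n > 0 \<and>
     (\<forall>W. VectorSpace.subspace class_ring W (module_vec TYPE('k) n) \<and>
          (\<forall>g \<in> carrier G. \<forall>w \<in> W. \<rho> g *\<^sub>v w \<in> W)
        \<longrightarrow> W = {0\<^sub>v n} \<or> W = carrier_vec n)"

text \<open>
  Characters are normalised to be \<open>undefined\<close> outside the carrier of the group, so that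
  equality of characters is equality of functions on the group.
\<close>

definition rep_character ::
    "('g, 'm) monoid_scheme \<Rightarrow> nat \<Rightarrow> ('g \<Rightarrow> 'k::field mat) \<Rightarrow> 'g \<Rightarrow> 'k" where
  "rep_character G n \<rho> = (\<lambda>g \<in> carrier G. \<Sum>i<n. \<rho> g $$ (i, i))"

definition irr_chars :: "'k::field itself \<Rightarrow> ('g, 'm) monoid_scheme \<Rightarrow> ('g \<Rightarrow> 'k) set" where
  "irr_chars K G = {rep_character G n \<rho> | n \<rho>. irreducible_rep G n \<rho>}"

text \<open>
  \<open>char_mult K G \<chi> \<psi>\<close> is the family of multiplicities \<open>N\<close> in
  \<open>\<chi> \<psi> = (\<Sum>\<phi>. N \<phi> \<cdot> \<phi>)\<close>; it is unique for finite \<open>G\<close> in characteristic zero, as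
  irreducible characters are then linearly independent.
\<close>

definition char_mult ::
    "'k::field itself \<Rightarrow> ('g, 'm) monoid_scheme \<Rightarrow> ('g \<Rightarrow> 'k) \<Rightarrow> ('g \<Rightarrow> 'k) \<Rightarrow> ('g \<Rightarrow> 'k) \<Rightarrow> nat" where
  "char_mult K G \<chi> \<psi> = (THE N.
     (\<forall>\<phi>. \<phi> \<notin> irr_chars K G \<longrightarrow> N \<phi> = 0) \<and>
     (\<forall>g \<in> carrier G. \<chi> g * \<psi> g = (\<Sum>\<phi> \<in> irr_chars K G. of_nat (N \<phi>) * \<phi> g)))"

text \<open>
  The degree \<open>\<chi>(1)\<close> lies in the field \<open>'k\<close>; in characteristic zero it determines a unique
  natural number, which can then be used in real-valued probabilities.
\<close>

definition char_degree :: "('g, 'm) monoid_scheme \<Rightarrow> ('g \<Rightarrow> 'k::field) \<Rightarrow> nat" where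
  "char_degree G \<chi> = (THE d. of_nat d = \<chi> \<one>\<^bsub>G\<^esub>)"

text \<open>
  The probability group \<open>A(kG)\<close> has the underlying set \<^term>\<open>irr_chars K G\<close> and the
  following probability map.
\<close>

definition char_prob ::
    "'k::field itself \<Rightarrow> ('g, 'm) monoid_scheme \<Rightarrow> ('g \<Rightarrow> 'k) \<Rightarrow> ('g \<Rightarrow> 'k) \<Rightarrow> ('g \<Rightarrow> 'k) \<Rightarrow> real" where
  "char_prob K G \<chi> \<psi> \<phi> =
     real (char_mult K G \<chi> \<psi> \<phi>) * real (char_degree G \<phi>)
       / (real (char_degree G \<chi>) * real (char_degree G \<psi>))"

end

theory Submission
  imports Defs "Jordan_Normal_Form.Char_Poly"
begin

text \<open>
  Let \<open>A\<close> be a \<open>2\<close>-integral probability group with finitely many elements. The numbers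
  \<open>d(a) = \<surd>s(a)\<close> and \<open>N(a,b,c) = p(a \<cdot> b = c) d(a) d(b) / d(c)\<close> are natural, determine \<open>p\<close>, and
  satisfy the axioms of a fusion ring with multiplicative dimension function \<open>d\<close>
  (\<open>integral_fusion_ring\<close>). With three elements there are few unknowns, and
  the dimension equations \<open>d(a) d(b) = (\<Sum>c. N(a,b,c) d(c))\<close> can be solved by divisibility: if the two
  elements other than the identity are inverse to each other, their dimension divides \<open>1\<close> and \<open>A\<close> is
  the cyclic group of order three; if they are self-inverse, their dimensions are coprime, and this
  leaves only the dimensions \<open>1, 1, 2\<close> with one multiplication table (\<open>self_dual_dims\<close>,
  \<open>three_element_classification\<close>).

  It remains to recognise the two tables as those of the character rings of \<open>\<int>\<^sub>3\<close> and of the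
  symmetric group on three letters, for which the irreducible characters have to be determined over
  an arbitrary algebraically closed field of characteristic zero. As eigenvectors exist over such a
  field, an irreducible representation of \<open>\<int>\<^sub>3\<close> has degree one
  (\<open>irr_chars_cyclic\<close>). For the symmetric group, an eigenvector of a \<open>3\<close>-cycle and its image under a
  transposition span an invariant subspace, so the degree is at most two; in degree two the
  traces are forced by the relations of the group (\<open>sym3_character_2\<close>), and the standard
  representation shows that this case occurs (\<open>irr_chars_sym\<close>). The structure of \<open>A(kG)\<close> is then read off from
  the lists of characters (\<open>char_prob_fusion\<close>) and transported from the tables.
  The two are not isomorphic, since only one of them has a probability different from \<open>0\<close> and \<open>1\<close>.
\<close>

section \<open>Integral probability groups as fusion rings\<close>

text \<open>
  The numbers \<open>N\<close> are thought of as the structure constants of a fusion ring and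
  \<open>d\<close> as its dimension function; the formula is that of the probability group
  \<open>A(kG)\<close>, with \<open>N\<close> the multiplicities and \<open>d\<close> the
  character degrees.
\<close>

definition fusion_prob :: "('i \<Rightarrow> 'i \<Rightarrow> 'i \<Rightarrow> nat) \<Rightarrow> ('i \<Rightarrow> nat) \<Rightarrow> 'i \<Rightarrow> 'i \<Rightarrow> 'i \<Rightarrow> real" where
  "fusion_prob N d i j k = real (N i j k) * real (d k) / (real (d i) * real (d j))"

context prob_group
begin

lemma one_unique:
  assumes "is_pg_one A p e" "is_pg_one A p f"
  shows "e = f"
proof (rule ccontr)
  assume ne: "e \<noteq> f"
  have mem: "e \<in> A" "f \<in> A" and val: "p e f e = 1" "p e f f = 1"
    using assms by (auto simp: is_pg_one_def)
  have "(\<Sum>c\<in>{e, f}. p e f c) \<le> (\<Sum>c \<in> pg_supp A p e f. p e f c)"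
    by (rule sum_mono2) (use mem val finite_supp nonneg in \<open>auto simp: pg_supp_def\<close>)
  then show False
    using sum_one[OF mem] val ne by simp
qed

lemma pg_one_is_one: "is_pg_one A p (pg_one A p)"
  unfolding pg_one_def using ex_one one_unique by (metis theI)

lemma one_closed: "pg_one A p \<in> A"
  using pg_one_is_one by (simp add: is_pg_one_def)

lemma inv_closed: "a \<in> A \<Longrightarrow> pg_inv A p a \<in> A"
  and inv_pos: "a \<in> A \<Longrightarrow> p a (pg_inv A p a) (pg_one A p) > 0"
  using theI'[OF ex1_inv] by (auto simp: pg_inv_def)

lemma inv_eqI: "\<lbrakk>a \<in> A; b \<in> A; p a b (pg_one A p) > 0\<rbrakk> \<Longrightarrow> pg_inv A p a = b"
  using ex1_inv[of a] inv_closed inv_pos by blast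

lemma inv_inv: "a \<in> A \<Longrightarrow> pg_inv A p (pg_inv A p a) = a"
  using inv_eqI[of "pg_inv A p a" a] inv_closed inv_pos inv_comm by simp

lemma inv_one: "pg_inv A p (pg_one A p) = pg_one A p"
  using inv_eqI[OF one_closed one_closed] pg_one_is_one by (simp add: is_pg_one_def)

lemma sum_one_finite:
  assumes "finite A" "a \<in> A" "b \<in> A"
  shows "(\<Sum>c\<in>A. p a b c) = 1"
proof -
  have "(\<Sum>c\<in>A. p a b c) = (\<Sum>c \<in> pg_supp A p a b. p a b c)"
    by (rule sum.mono_neutral_right) (use assms in \<open>auto simp: pg_supp_def\<close>)
  then show ?thesis using sum_one assms by simp
qed

lemma assoc_finite:
  assumes "finite A" "a \<in> A" "b \<in> A" "c \<in> A" "d \<in> A"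
  shows "(\<Sum>x\<in>A. p a b x * p x c d) = (\<Sum>y\<in>A. p a y d * p b c y)"
proof -
  have "(\<Sum>x\<in>A. p a b x * p x c d) = (\<Sum>x \<in> pg_supp A p a b. p a b x * p x c d)"
    by (rule sum.mono_neutral_right) (use assms in \<open>auto simp: pg_supp_def\<close>)
  moreover have "(\<Sum>y\<in>A. p a y d * p b c y) = (\<Sum>y \<in> pg_supp A p b c. p a y d * p b c y)"
    by (rule sum.mono_neutral_right) (use assms in \<open>auto simp: pg_supp_def\<close>)
  ultimately show ?thesis using assoc[of a b c d] assms by simp
qed

text \<open>
  Non-negative values with sum \<open>1\<close> leave no room for a second product. This is
  applied to products with the identity.
\<close>

lemma certain_product:
  assumes "finite A" "a \<in> A" "b \<in> A" "x \<in> A" "p a b x = 1" "c \<in> A"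
  shows "p a b c = of_bool (c = x)"
proof -
  have "1 = p a b x + (\<Sum>y\<in>A - {x}. p a b y)"
    using sum_one_finite[OF assms(1-3)] assms(1,4) by (simp add: sum.remove)
  then have "(\<Sum>y\<in>A - {x}. p a b y) = 0" using assms(5) by simp
  then have "\<forall>y\<in>A - {x}. p a b y = 0"
    using sum_nonneg_eq_0_iff[of "A - {x}" "p a b"] assms nonneg by simp
  then show ?thesis using assms by auto
qed

lemma size_inv:
  assumes "a \<in> A"
  shows "pg_size A p (pg_inv A p a) = pg_size A p a"
  using assms inv_inv inv_comm by (simp add: pg_size_def)

end

text \<open>
  Rescaling: put \<open>d(a) = \<surd>s(a)\<close> and \<open>N(a,b,c) = p(a \<cdot> b = c)
  d(a) d(b) / d(c)\<close>. Integrality says that both are natural numbers. The axiom that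
  probabilities sum to \<open>1\<close> turns into multiplicativity of \<open>d\<close>,
  associativity of \<open>p\<close> into associativity of \<open>N\<close> since the factors
  \<open>d(x)\<close> of the intermediate terms cancel, and the definition of the size says
  precisely that the identity occurs in \<open>a \<cdot> a\<inverse>\<close> with multiplicity
  \<open>1\<close>. What remains are equations between natural numbers, to which divisibility
  arguments apply.
\<close>

lemma (in prob_group) integral_fusion_ring:
  assumes fin: "finite A" and int: "pg_integral 2 A p"
  defines "e \<equiv> pg_one A p" and "s \<equiv> pg_inv A p"
  obtains N :: "'a \<Rightarrow> 'a \<Rightarrow> 'a \<Rightarrow> nat" and d :: "'a \<Rightarrow> nat" where
    "\<And>a b c. \<lbrakk>a \<in> A; b \<in> A; c \<in> A\<rbrakk> \<Longrightarrow> p a b c = fusion_prob N d a b c"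
    "\<And>a. a \<in> A \<Longrightarrow> d a > 0" "d e = 1" "\<And>a. a \<in> A \<Longrightarrow> d (s a) = d a"
    "\<And>a b. \<lbrakk>a \<in> A; b \<in> A\<rbrakk> \<Longrightarrow> (\<Sum>c\<in>A. N a b c * d c) = d a * d b"
    "\<And>a b c f. \<lbrakk>a \<in> A; b \<in> A; c \<in> A; f \<in> A\<rbrakk> \<Longrightarrow>
      (\<Sum>x\<in>A. N a b x * N x c f) = (\<Sum>y\<in>A. N a y f * N b c y)"
    "\<And>a b. \<lbrakk>a \<in> A; b \<in> A\<rbrakk> \<Longrightarrow> N e a b = of_bool (b = a)"
    "\<And>a b. \<lbrakk>a \<in> A; b \<in> A\<rbrakk> \<Longrightarrow> N a e b = of_bool (b = a)"
    "\<And>a b. \<lbrakk>a \<in> A; b \<in> A\<rbrakk> \<Longrightarrow> N a b e = of_bool (b = s a)"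
    "\<And>a b c. \<lbrakk>a \<in> A; b \<in> A; c \<in> A\<rbrakk> \<Longrightarrow> N a b c = N (s b) (s a) (s c)"
proof -
  let ?r = "\<lambda>a. root 2 (pg_size A p a)"
  define d where "d a = nat \<lfloor>?r a\<rfloor>" for a
  define N where "N a b c = nat \<lfloor>p a b c * ?r a * ?r b / ?r c\<rfloor>" for a b c
  have eA: "e \<in> A" and sA: "\<And>a. a \<in> A \<Longrightarrow> s a \<in> A"
    using one_closed inv_closed by (auto simp: e_def s_def)
  have size_pos: "pg_size A p a > 0" if "a \<in> A" for a
    using inv_pos[OF that] by (simp add: pg_size_def)
  have d: "real (d a) = ?r a" if a: "a \<in> A" for a
  proof -
    have "?r a \<in> \<int>" using int a by (simp add: pg_integral_def)
    then show ?thesis using size_pos[OF a] by (auto simp: d_def elim!: Ints_cases)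
  qed
  have dpos: "d a > 0" if a: "a \<in> A" for a
    using d[OF a] size_pos[OF a] by (metis of_nat_0_less_iff real_root_gt_zero zero_less_numeral)
  have dne: "d a \<noteq> 0" if "a \<in> A" for a using dpos[OF that] by simp
  have N: "real (N a b c) = p a b c * real (d a) * real (d b) / real (d c)"
    if "a \<in> A" "b \<in> A" "c \<in> A" for a b c
  proof -
    have "p a b c * ?r a * ?r b / ?r c \<in> \<nat>" using int that by (simp add: pg_integral_def)
    then show ?thesis using d that by (auto simp: N_def elim!: Nats_cases)
  qed
  have p: "p a b c = fusion_prob N d a b c" if "a \<in> A" "b \<in> A" "c \<in> A" for a b c
    using N[OF that] dpos[OF that(1)] dpos[OF that(2)] dpos[OF that(3)]
    by (simp add: fusion_prob_def)
  have d_sq: "(real (d a))\<^sup>2 = pg_size A p a" if a: "a \<in> A" for a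
    using d[OF a] size_pos[OF a] by simp
  have ee: "p e e e = 1" using pg_one_is_one by (simp add: is_pg_one_def e_def)
  have de: "d e = 1"
  proof -
    have "(real (d e))\<^sup>2 = 1"
      using d_sq[OF eA] ee inv_one[folded e_def] by (simp add: pg_size_def flip: e_def)
    then show ?thesis by (simp add: power2_eq_1_iff)
  qed
  have ds: "d (s a) = d a" if a: "a \<in> A" for a
    using d[OF a] d[OF sA[OF a]] size_inv[OF a] by (simp add: s_def)
  have dim: "(\<Sum>c\<in>A. N a b c * d c) = d a * d b" if "a \<in> A" "b \<in> A" for a b
  proof -
    have "real (\<Sum>c\<in>A. N a b c * d c) = (\<Sum>c\<in>A. p a b c * (real (d a) * real (d b)))"
      unfolding of_nat_sum of_nat_mult
      by (rule sum.cong) (use that in \<open>simp_all add: N dne\<close>)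
    also have "\<dots> = (\<Sum>c\<in>A. p a b c) * (real (d a) * real (d b))"
      by (simp only: sum_distrib_right)
    also have "\<dots> = real (d a * d b)" using sum_one_finite[OF fin that] by simp
    finally show ?thesis by (simp only: of_nat_eq_iff)
  qed
  have ass: "(\<Sum>x\<in>A. N a b x * N x c f) = (\<Sum>y\<in>A. N a y f * N b c y)"
    if "a \<in> A" "b \<in> A" "c \<in> A" "f \<in> A" for a b c f
  proof -
    let ?c = "real (d a) * real (d b) * real (d c) / real (d f)"
    have "real (\<Sum>x\<in>A. N a b x * N x c f) = (\<Sum>x\<in>A. p a b x * p x c f * ?c)"
      unfolding of_nat_sum of_nat_mult
      by (rule sum.cong) (use that in \<open>simp_all add: N dne\<close>)
    also have "\<dots> = (\<Sum>x\<in>A. p a b x * p x c f) * ?c" by (simp only: sum_distrib_right)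
    also have "\<dots> = (\<Sum>y\<in>A. p a y f * p b c y) * ?c" using assoc_finite[OF fin that] by simp
    also have "\<dots> = (\<Sum>y\<in>A. p a y f * p b c y * ?c)" by (simp only: sum_distrib_right)
    also have "\<dots> = real (\<Sum>y\<in>A. N a y f * N b c y)"
      unfolding of_nat_sum of_nat_mult
      by (rule sum.cong) (use that in \<open>simp_all add: N dne\<close>)
    finally show ?thesis by (simp only: of_nat_eq_iff)
  qed
  have units: "N e a b = of_bool (b = a)" "N a e b = of_bool (b = a)"
    if a: "a \<in> A" and b: "b \<in> A" for a b
  proof -
    have "p e a a = 1" "p a e a = 1"
      using pg_one_is_one a by (auto simp: is_pg_one_def e_def)
    then have "p e a b = of_bool (b = a)" "p a e b = of_bool (b = a)"
      using certain_product[OF fin eA a a _ b] certain_product[OF fin a eA a _ b] by auto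
    then have "real (N e a b) = of_bool (b = a)" "real (N a e b) = of_bool (b = a)"
      using N[OF eA a b] N[OF a eA b] dpos[OF a] de by auto
    then show "N e a b = of_bool (b = a)" "N a e b = of_bool (b = a)"
      by (auto split: if_splits)
  qed
  have dual: "N a b e = of_bool (b = s a)" if a: "a \<in> A" and b: "b \<in> A" for a b
  proof (cases "b = s a")
    case True
    have "p a b e * (real (d a))\<^sup>2 = 1"
      using inv_pos[OF a] by (simp add: d_sq[OF a] pg_size_def True s_def e_def)
    then have "real (N a b e) = 1"
      using N[OF a b eA] de ds[OF a] True by (simp add: power2_eq_square mult.assoc)
    then show ?thesis using True by simp
  next
    case False
    then have "\<not> p a b e > 0" using inv_eqI[OF a b] by (auto simp: e_def s_def)
    then have "p a b e = 0" using nonneg[OF a b eA] by simp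
    then show ?thesis using N[OF a b eA] False by simp
  qed
  have swap: "N a b c = N (s b) (s a) (s c)" if "a \<in> A" "b \<in> A" "c \<in> A" for a b c
  proof -
    have "real (N a b c) = real (N (s b) (s a) (s c))"
      using N[OF that] N[OF sA sA sA, of b a c] that ds inv_swap[OF that]
      by (simp add: s_def mult.assoc mult.commute mult.left_commute)
    then show ?thesis by simp
  qed
  show ?thesis using that[OF p dpos de ds dim ass units dual swap] .
qed

section \<open>Finite probability groups and isomorphisms\<close>

text \<open>
  With a candidate identity \<open>e\<close> and a candidate inversion \<open>j\<close> at
  hand, the definite descriptions in the axioms can be evaluated. Sums over supports become
  sums over the whole finite set.
\<close>

lemma finite_prob_groupI:
  fixes A :: "'a set"
  assumes fin: "finite A"
    and nonneg: "\<And>a b c. \<lbrakk>a \<in> A; b \<in> A; c \<in> A\<rbrakk> \<Longrightarrow> p a b c \<ge> 0"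
    and sum1: "\<And>a b. \<lbrakk>a \<in> A; b \<in> A\<rbrakk> \<Longrightarrow> (\<Sum>c\<in>A. p a b c) = 1"
    and assoc: "\<And>a b c d. \<lbrakk>a \<in> A; b \<in> A; c \<in> A; d \<in> A\<rbrakk> \<Longrightarrow>
      (\<Sum>x\<in>A. p a b x * p x c d) = (\<Sum>y\<in>A. p a y d * p b c y)"
    and one: "is_pg_one A p e"
    and j_closed: "\<And>a. a \<in> A \<Longrightarrow> j a \<in> A"
    and j_pos: "\<And>a b. \<lbrakk>a \<in> A; b \<in> A\<rbrakk> \<Longrightarrow> p a b e > 0 \<longleftrightarrow> b = j a"
    and j_swap: "\<And>a b c. \<lbrakk>a \<in> A; b \<in> A; c \<in> A\<rbrakk> \<Longrightarrow> p a b c = p (j b) (j a) (j c)"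
    and j_comm: "\<And>a. a \<in> A \<Longrightarrow> p a (j a) e = p (j a) a e"
  shows "prob_group A p" and "pg_one A p = e" and "\<And>a. a \<in> A \<Longrightarrow> pg_inv A p a = j a"
proof -
  have supp: "(\<Sum>x \<in> pg_supp A p a b. p a b x) = (\<Sum>x\<in>A. p a b x)"
    "(\<Sum>x \<in> pg_supp A p a b. p a b x * f x) = (\<Sum>x\<in>A. p a b x * f x)"
    "(\<Sum>x \<in> pg_supp A p a b. f x * p a b x) = (\<Sum>x\<in>A. f x * p a b x)" for a b f
    by (rule sum.mono_neutral_left, use fin in \<open>auto simp: pg_supp_def\<close>)+
  have uniq: "f = e" if f: "is_pg_one A p f" for f
  proof (rule ccontr)
    assume "f \<noteq> e"
    moreover have "(\<Sum>c\<in>{e, f}. p e f c) \<le> (\<Sum>c\<in>A. p e f c)"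
      by (rule sum_mono2) (use fin nonneg one f in \<open>auto simp: is_pg_one_def\<close>)
    ultimately show False
      using sum1[of e f] one f by (simp add: is_pg_one_def)
  qed
  show one_eq: "pg_one A p = e"
    unfolding pg_one_def using one uniq by (rule the_equality)
  show inv_eq: "pg_inv A p a = j a" if "a \<in> A" for a
    unfolding pg_inv_def one_eq by (rule the_equality) (use that j_closed j_pos in auto)
  show "prob_group A p"
  proof
    show "finite (pg_supp A p a b)" for a b
      using fin by (simp add: pg_supp_def)
    show "\<exists>!b. b \<in> A \<and> p a b (pg_one A p) > 0" if "a \<in> A" for a
      unfolding one_eq by (rule ex1I[of _ "j a"]) (use that j_closed j_pos in auto)
    show "p a b c = p (pg_inv A p b) (pg_inv A p a) (pg_inv A p c)"
      if "a \<in> A" "b \<in> A" "c \<in> A" for a b c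
      using j_swap[of a b c] inv_eq that by simp
    show "p a (pg_inv A p a) (pg_one A p) = p (pg_inv A p a) a (pg_one A p)"
      if "a \<in> A" for a
      using that inv_eq one_eq j_comm[of a] by simp
    show "(\<Sum>x \<in> pg_supp A p a b. p a b x * p x c d) = (\<Sum>y \<in> pg_supp A p b c. p a y d * p b c y)"
      if "a \<in> A" "b \<in> A" "c \<in> A" "d \<in> A" for a b c d
      unfolding supp using that by (rule assoc)
    show "(\<Sum>c \<in> pg_supp A p a b. p a b c) = 1" if "a \<in> A" "b \<in> A" for a b
      unfolding supp using that by (rule sum1)
    show "\<exists>e. is_pg_one A p e" using one by blast
  qed (fact nonneg)
qed

lemma pg_isomorphic_sym:
  assumes "pg_isomorphic A p B q"
  shows "pg_isomorphic B q A p"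
proof -
  obtain f where f: "bij_betw f A B" "\<forall>a\<in>A. \<forall>b\<in>A. \<forall>c\<in>A. q (f a) (f b) (f c) = p a b c"
    using assms unfolding pg_isomorphic_def by blast
  have "p (inv_into A f a) (inv_into A f b) (inv_into A f c) = q a b c"
    if "a \<in> B" "b \<in> B" "c \<in> B" for a b c
    using f(2)[rule_format, of "inv_into A f a" "inv_into A f b" "inv_into A f c"] that
      bij_betw_inv_into_right[OF f(1)] bij_betwE[OF bij_betw_inv_into[OF f(1)]]
    by simp
  then show ?thesis
    unfolding pg_isomorphic_def using bij_betw_inv_into[OF f(1)] by blast
qed

lemma pg_isomorphic_trans:
  assumes "pg_isomorphic A p B q" "pg_isomorphic B q C r"
  shows "pg_isomorphic A p C r"
proof -
  obtain f where f: "bij_betw f A B" "\<forall>a\<in>A. \<forall>b\<in>A. \<forall>c\<in>A. q (f a) (f b) (f c) = p a b c"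
    using assms(1) unfolding pg_isomorphic_def by blast
  obtain g where g: "bij_betw g B C" "\<forall>a\<in>B. \<forall>b\<in>B. \<forall>c\<in>B. r (g a) (g b) (g c) = q a b c"
    using assms(2) unfolding pg_isomorphic_def by blast
  have "f a \<in> B" if "a \<in> A" for a using f(1) that bij_betwE by blast
  then have "\<forall>a\<in>A. \<forall>b\<in>A. \<forall>c\<in>A. r ((g \<circ> f) a) ((g \<circ> f) b) ((g \<circ> f) c) = p a b c"
    using f(2) g(2) by simp
  then show ?thesis
    unfolding pg_isomorphic_def using bij_betw_trans[OF f(1) g(1)] by blast
qed

lemma pg_isomorphic_card: "pg_isomorphic A p B q \<Longrightarrow> card A = card B"
  unfolding pg_isomorphic_def using bij_betw_same_card by blast

text \<open>
  Isomorphisms are only required to preserve \<open>p\<close>; identity, inverses and hence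
  sizes are preserved because they are determined by \<open>p\<close>.
\<close>

lemma finite_prob_group_transport:
  assumes iso: "pg_isomorphic A p B q" and pg: "prob_group A p" and fin: "finite A"
  shows "prob_group B q" and "pg_integral r A p \<Longrightarrow> pg_integral r B q"
proof -
  interpret prob_group A p by fact
  obtain f where f: "bij_betw f A B"
    and pres: "\<And>a b c. \<lbrakk>a \<in> A; b \<in> A; c \<in> A\<rbrakk> \<Longrightarrow> q (f a) (f b) (f c) = p a b c"
    using iso unfolding pg_isomorphic_def by blast
  define g where "g = inv_into A f"
  have gA: "g b \<in> A" and fg: "f (g b) = b" if "b \<in> B" for b
    using that f bij_betwE[OF bij_betw_inv_into[OF f]] bij_betw_inv_into_right[OF f]
    by (auto simp: g_def)
  have gf: "g (f a) = a" if "a \<in> A" for a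
    using that f by (simp add: g_def bij_betw_inv_into_left)
  have fB: "f a \<in> B" if "a \<in> A" for a using that f bij_betwE by blast
  have q: "q a b c = p (g a) (g b) (g c)" if "a \<in> B" "b \<in> B" "c \<in> B" for a b c
    using pres[of "g a" "g b" "g c"] gA fg that by simp
  have reindex: "(\<Sum>x\<in>B. h x) = (\<Sum>x\<in>A. h (f x))" for h :: "'b \<Rightarrow> real"
    by (rule sum.reindex_bij_betw[OF f, symmetric])
  define j where "j b = f (pg_inv A p (g b))" for b
  note clo = gA fg gf fB inv_closed one_closed
  note I = finite_prob_groupI[of B q "f (pg_one A p)" j]
  have H1: "finite B" using f fin bij_betw_finite by blast
  have H2: "q a b c \<ge> 0" if "a \<in> B" "b \<in> B" "c \<in> B" for a b c
    using that q clo nonneg by simp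
  have H3: "(\<Sum>c\<in>B. q a b c) = 1" if "a \<in> B" "b \<in> B" for a b
    unfolding reindex using that q clo sum_one_finite[OF fin, of "g a" "g b"] by simp
  have H4: "(\<Sum>x\<in>B. q a b x * q x c d) = (\<Sum>y\<in>B. q a y d * q b c y)"
    if "a \<in> B" "b \<in> B" "c \<in> B" "d \<in> B" for a b c d
    unfolding reindex using that q clo assoc_finite[OF fin, of "g a" "g b" "g c" "g d"] by simp
  have H5: "is_pg_one B q (f (pg_one A p))"
    using pg_one_is_one q clo by (simp add: is_pg_one_def)
  have H6: "j a \<in> B" if "a \<in> B" for a using that clo by (simp add: j_def)
  have H7: "q a b (f (pg_one A p)) > 0 \<longleftrightarrow> b = j a" if "a \<in> B" "b \<in> B" for a b
  proof -
    have "q a b (f (pg_one A p)) > 0 \<longleftrightarrow> p (g a) (g b) (pg_one A p) > 0"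
      using that q clo by simp
    also have "\<dots> \<longleftrightarrow> g b = pg_inv A p (g a)"
      using that clo inv_eqI inv_pos by metis
    also have "\<dots> \<longleftrightarrow> b = j a"
      using that clo by (metis j_def)
    finally show ?thesis .
  qed
  have H8: "q a b c = q (j b) (j a) (j c)" if "a \<in> B" "b \<in> B" "c \<in> B" for a b c
    using that q clo inv_swap[of "g a" "g b" "g c"] by (simp add: j_def)
  have H9: "q a (j a) (f (pg_one A p)) = q (j a) a (f (pg_one A p))" if "a \<in> B" for a
    using that q clo inv_comm[of "g a"] by (simp add: j_def)
  show "prob_group B q"
    by (rule I(1)) (fact H1 H2 H3 H4 H5 H6 H7 H8 H9)+
  have one: "pg_one B q = f (pg_one A p)"
    by (rule I(2)) (fact H1 H2 H3 H4 H5 H6 H7 H8 H9)+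
  have inv: "pg_inv B q b = j b" if "b \<in> B" for b
    by (rule I(3)) (fact H1 H2 H3 H4 H5 H6 H7 H8 H9 that)+
  have size: "pg_size B q b = pg_size A p (g b)" if "b \<in> B" for b
    using that q clo one inv by (simp add: pg_size_def j_def)
  show "pg_integral r B q" if "pg_integral r A p"
    using that gA unfolding pg_integral_def by (auto simp: size q)
qed

section \<open>The two multiplication tables\<close>

text \<open>
  The converse of the rescaling of an integral probability group: a fusion ring with integral
  dimensions yields a probability group of sizes \<open>d(i)\<^sup>2\<close>.
\<close>

lemma fusion_ring_prob_group:
  fixes N :: "'i \<Rightarrow> 'i \<Rightarrow> 'i \<Rightarrow> nat"
  assumes fin: "finite I" and e: "e \<in> I" and de: "d e = 1"
    and pos: "\<forall>i\<in>I. d i > 0"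
    and dim: "\<forall>i\<in>I. \<forall>j\<in>I. (\<Sum>k\<in>I. N i j k * d k) = d i * d j"
    and assoc: "\<forall>i\<in>I. \<forall>j\<in>I. \<forall>k\<in>I. \<forall>l\<in>I. (\<Sum>x\<in>I. N i j x * N x k l) = (\<Sum>y\<in>I. N i y l * N j k y)"
    and unit: "\<forall>i\<in>I. N e i i = 1 \<and> N i e i = 1"
    and star: "\<forall>i\<in>I. s i \<in> I \<and> d (s i) = d i \<and> s (s i) = i"
    and dual: "\<forall>i\<in>I. \<forall>j\<in>I. N i j e = of_bool (j = s i)"
    and swap: "\<forall>i\<in>I. \<forall>j\<in>I. \<forall>k\<in>I. N i j k = N (s j) (s i) (s k)"
  shows "prob_group I (fusion_prob N d)" and "pg_integral 2 I (fusion_prob N d)"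
proof -
  let ?p = "fusion_prob N d"
  note I = finite_prob_groupI[of I ?p e s]
  have H1: "?p i j k \<ge> 0" if "i \<in> I" "j \<in> I" "k \<in> I" for i j k
    by (simp add: fusion_prob_def)
  have H2: "(\<Sum>k\<in>I. ?p i j k) = 1" if "i \<in> I" "j \<in> I" for i j
  proof -
    have "(\<Sum>k\<in>I. ?p i j k) = real (\<Sum>k\<in>I. N i j k * d k) / (real (d i) * real (d j))"
      by (simp add: fusion_prob_def sum_divide_distrib)
    also have "\<dots> = 1"
      using dim[rule_format, OF that] pos[rule_format, OF that(1)] pos[rule_format, OF that(2)]
      by simp
    finally show ?thesis .
  qed
  have H3: "(\<Sum>x\<in>I. ?p i j x * ?p x k l) = (\<Sum>y\<in>I. ?p i y l * ?p j k y)"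
    if "i \<in> I" "j \<in> I" "k \<in> I" "l \<in> I" for i j k l
  proof -
    let ?c = "real (d l) / (real (d i) * real (d j) * real (d k))"
    have "(\<Sum>x\<in>I. ?p i j x * ?p x k l) = (\<Sum>x\<in>I. real (N i j x * N x k l) * ?c)"
      by (rule sum.cong) (use pos in \<open>auto simp: fusion_prob_def field_simps\<close>)
    also have "\<dots> = real (\<Sum>x\<in>I. N i j x * N x k l) * ?c"
      by (simp only: sum_distrib_right of_nat_sum)
    also have "\<dots> = real (\<Sum>y\<in>I. N i y l * N j k y) * ?c"
      using assoc that by simp
    also have "\<dots> = (\<Sum>y\<in>I. real (N i y l * N j k y) * ?c)"
      by (simp only: sum_distrib_right of_nat_sum)
    also have "\<dots> = (\<Sum>y\<in>I. ?p i y l * ?p j k y)"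
      by (rule sum.cong) (use pos in \<open>auto simp: fusion_prob_def field_simps\<close>)
    finally show ?thesis .
  qed
  have H4: "is_pg_one I ?p e"
    using e de unit pos by (auto simp: is_pg_one_def fusion_prob_def)
  have H5: "s i \<in> I" if "i \<in> I" for i using star that by simp
  have H6: "?p i j e > 0 \<longleftrightarrow> j = s i" if "i \<in> I" "j \<in> I" for i j
    using that pos dual de star by (simp add: fusion_prob_def)
  have H7: "?p i j k = ?p (s j) (s i) (s k)" if "i \<in> I" "j \<in> I" "k \<in> I" for i j k
    using swap[rule_format, OF that] star that by (simp add: fusion_prob_def mult.commute)
  have H8: "?p i (s i) e = ?p (s i) i e" if "i \<in> I" for i
    using that dual star by (simp add: fusion_prob_def mult.commute)
  show "prob_group I ?p"
    by (rule I(1)) (fact fin H1 H2 H3 H4 H5 H6 H7 H8)+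
  have one: "pg_one I ?p = e"
    by (rule I(2)) (fact fin H1 H2 H3 H4 H5 H6 H7 H8)+
  have inv: "pg_inv I ?p i = s i" if "i \<in> I" for i
    by (rule I(3)) (fact fin H1 H2 H3 H4 H5 H6 H7 H8 that)+
  have root: "root 2 (pg_size I ?p i) = real (d i)" if "i \<in> I" for i
  proof -
    have "pg_size I ?p i = (real (d i))\<^sup>2"
      using that star dual de by (simp add: pg_size_def one inv fusion_prob_def power2_eq_square)
    then show ?thesis by (simp add: real_root_power_cancel)
  qed
  have "?p i j k * real (d i) * real (d j) / real (d k) = real (N i j k)"
    if "i \<in> I" "j \<in> I" "k \<in> I" for i j k
    using pos that by (simp add: fusion_prob_def)
  then show "pg_integral 2 I ?p"
    unfolding pg_integral_def using root by simp
qed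

text \<open>
  The character rings of \<open>\<int>\<^sub>3\<close> and of the symmetric group on three
  letters. In the first, the irreducible characters \<open>0, 1, 2\<close> form a cyclic group
  of order three. In the second, \<open>0\<close> is the trivial character, \<open>1\<close>
  the sign and \<open>2\<close> the character of degree two.
\<close>

definition cyclic_table :: "nat \<Rightarrow> nat \<Rightarrow> nat \<Rightarrow> nat" where
  "cyclic_table i j k = of_bool (k = (i + j) mod 3)"

definition sym_table :: "nat \<Rightarrow> nat \<Rightarrow> nat \<Rightarrow> nat" where
  "sym_table i j k =
     (if i = 2 \<and> j = 2 then 1
      else if i = 2 \<or> j = 2 then of_bool (k = 2)
      else of_bool (k = (i + j) mod 2))"

definition sym_dim :: "nat \<Rightarrow> nat" where
  "sym_dim i = (if i = 2 then 2 else 1)"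

abbreviation "cyclic_prob \<equiv> fusion_prob cyclic_table (\<lambda>_. 1)"
abbreviation "sym_prob \<equiv> fusion_prob sym_table sym_dim"

lemma finite_012: "finite {0, 1, 2 :: nat}"
  by simp

lemma cyclic_prob_group: "prob_group {0,1,2} cyclic_prob"
  and cyclic_prob_integral: "pg_integral 2 {0,1,2} cyclic_prob"
  by (rule fusion_ring_prob_group[where e = 0 and s = "\<lambda>i. (3 - i) mod 3", OF finite_012]; code_simp)+

lemma sym_prob_group: "prob_group {0,1,2} sym_prob"
  and sym_prob_integral: "pg_integral 2 {0,1,2} sym_prob"
  by (rule fusion_ring_prob_group[where e = 0 and s = "\<lambda>i. i", OF finite_012]; code_simp)+

text \<open>
  In the cyclic table all probabilities are \<open>0\<close> or \<open>1\<close>, but the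
  square of the character of degree two contains the trivial character with probability
  \<open>1/4\<close>.
\<close>

lemma sym_not_iso_cyclic: "\<not> pg_isomorphic {0,1,2} sym_prob {0,1,2} cyclic_prob"
proof
  assume "pg_isomorphic {0,1,2} sym_prob {0,1,2} cyclic_prob"
  then obtain f :: "nat \<Rightarrow> nat" where "cyclic_prob (f 2) (f 2) (f 0) = sym_prob 2 2 0"
    unfolding pg_isomorphic_def by blast
  then show False
    by (auto simp: fusion_prob_def cyclic_table_def sym_table_def sym_dim_def of_bool_def split: if_splits)
qed

section \<open>Classification of the tables with three elements\<close>

text \<open>
  The dimension equation for \<open>a \<cdot> a\<inverse>\<close> when \<open>a\<close> and
  \<open>a\<inverse>\<close> are the two elements different from the identity. Both have the
  same dimension \<open>d\<close>, and they occur with the same multiplicity \<open>z\<close>,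
  since inversion maps \<open>a \<cdot> a\<inverse>\<close> to itself and exchanges them. So
  \<open>d\<close> divides \<open>1\<close>.
\<close>

lemma dual_pair_dim:
  fixes x z d :: nat
  assumes d: "d > 0" and ab: "d * d = 1 + z * d + z * d"
  shows "d = 1" "z = 0"
proof -
  have "d dvd 1 + z * d + z * d" using ab by (metis dvd_triv_left)
  then show "d = 1" by (metis dvd_add_left_iff dvd_triv_right nat_dvd_1_iff_1)
  then show "z = 0" using ab by simp
qed

text \<open>
  The dimension equations for two self-inverse elements \<open>a\<close>, \<open>b\<close> with
  dimensions \<open>m\<close>, \<open>n\<close> and products \<open>aa = 1 + xa + yb\<close>,
  \<open>ab = ya + wb\<close>, \<open>bb = 1 + wa + vb\<close>. The first equation makes
  \<open>m\<close> and \<open>n\<close> coprime, so the second one gives \<open>n | y\<close>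
  and \<open>m | w\<close>; after division by \<open>mn\<close> it says that \<open>y/n + w/m =
  1\<close>. Hence one of \<open>y\<close>, \<open>w\<close> vanishes, say \<open>y\<close>.
  Then \<open>m\<close> divides \<open>1\<close>, and the last equation becomes
  \<open>n\<^sup>2 = 2 + vn\<close>, which forces \<open>n = 2\<close>.
\<close>

lemma self_dual_dims:
  fixes x y u v w m n :: nat
  assumes pos: "m > 0" "n > 0"
    and aa: "m * m = 1 + x * m + y * n"
    and ab: "m * n = y * m + w * n"
    and bb: "n * n = 1 + w * m + v * n"
  shows "(m = 1 \<and> n = 2 \<and> x = 0 \<and> y = 0 \<and> w = 1 \<and> v = 1) \<or>
    (m = 2 \<and> n = 1 \<and> x = 1 \<and> y = 1 \<and> w = 0 \<and> v = 0)"
proof -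
  \<comment> \<open>The case \<open>y = 0\<close>; it is used a second time with the roles of \<open>a\<close> and \<open>b\<close> exchanged.\<close>
  have key: "m = 1 \<and> n = 2 \<and> x = 0 \<and> w = 1 \<and> v = 1"
    if "n > 0" "m > 0" "m * m = 1 + x * m" "m * n = w * n" "n * n = 1 + w * m + v * n"
    for x v w m n :: nat
  proof -
    have "m dvd 1" using that(3) by (metis dvd_add_left_iff dvd_triv_left dvd_triv_right)
    then have m: "m = 1" by simp
    then have w: "w = 1" and x: "x = 0" using that by simp_all
    have nn: "n * n = 2 + v * n" using that(5) m w by simp
    then have "n dvd 2" by (metis dvd_add_left_iff dvd_triv_left dvd_triv_right)
    then have "n = 1 \<or> n = 2" using two_is_prime_nat prime_nat_iff by blast
    then show ?thesis using nn m w x by auto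
  qed
  have "coprime m n"
  proof (rule coprimeI)
    fix c assume c: "c dvd m" "c dvd n"
    then have "c dvd 1 + x * m + y * n" using aa by (metis dvd_mult)
    then show "c dvd 1" using c by (metis dvd_add_left_iff dvd_mult)
  qed
  moreover have "m dvd w * n" "n dvd y * m"
    using ab by (metis dvd_add_right_iff dvd_triv_left dvd_triv_right add.commute)+
  ultimately obtain w' y' where w': "w = m * w'" and y': "y = n * y'"
    by (metis coprime_dvd_mult_left_iff coprime_commute dvdE)
  have "m * n * (y' + w') = n * y' * m + m * w' * n" by (simp add: algebra_simps)
  also have "\<dots> = m * n" using ab w' y' by (simp only:)
  finally have "y' + w' = 1" using pos by simp
  then consider "y' = 0" "w' = 1" | "y' = 1" "w' = 0" by linarith
  then show ?thesis
  proof cases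
    case 1
    then have y: "y = 0" using y' by simp
    have "m * m = 1 + x * m" "m * n = w * n" using aa ab y by simp_all
    from key[OF pos(2,1) this bb] show ?thesis using y by simp
  next
    case 2
    then have w: "w = 0" using w' by simp
    have "n * n = 1 + v * n" "n * m = y * m" "m * m = 1 + y * n + x * m"
      using aa ab bb w by (simp_all add: mult.commute)
    from key[OF pos this] show ?thesis using w by simp
  qed
qed

lemma fusion_table_iso:
  fixes f :: "'i \<Rightarrow> 'a"
  assumes bij: "bij_betw f I A"
    and p: "\<And>a b c. \<lbrakk>a \<in> A; b \<in> A; c \<in> A\<rbrakk> \<Longrightarrow> p a b c = fusion_prob N d a b c"
    and N: "\<forall>i\<in>I. \<forall>j\<in>I. \<forall>k\<in>I. N (f i) (f j) (f k) = M i j k"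
    and d: "\<forall>i\<in>I. d (f i) = m i"
  shows "pg_isomorphic I (fusion_prob M m) A p"
proof -
  have "f i \<in> A" if "i \<in> I" for i using bij that bij_betwE by blast
  then have "\<forall>i\<in>I. \<forall>j\<in>I. \<forall>k\<in>I. p (f i) (f j) (f k) = fusion_prob M m i j k"
    using p N d by (simp add: fusion_prob_def)
  then show ?thesis using bij unfolding pg_isomorphic_def by blast
qed

text \<open>
  Inversion fixes the identity \<open>e\<close>, so it either exchanges the other two elements
  \<open>a\<close>, \<open>b\<close> or fixes both. If it exchanges them, all dimensions are
  \<open>1\<close>, so \<open>aa\<close> is a single element. It is not \<open>e\<close>, and
  associativity excludes \<open>a\<close>, which leaves \<open>b\<close>: the cyclic group of
  order three. If it fixes them, inversion symmetry gives commutativity; comparing the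
  coefficients of \<open>e\<close> in \<open>(aa)b = a(ab)\<close> and \<open>(bb)a =
  b(ba)\<close> brings the products into the form required for the dimension equations, whose
  two solutions differ by exchanging \<open>a\<close> and \<open>b\<close>.
\<close>

lemma three_element_classification:
  assumes pg: "prob_group A p" and card: "card A = 3" and int: "pg_integral 2 A p"
  shows "pg_isomorphic {0,1,2} sym_prob A p \<or> pg_isomorphic {0,1,2} cyclic_prob A p"
proof -
  interpret prob_group A p by fact
  have fin: "finite A" using card by (simp add: card_ge_0_finite)
  define e where "e = pg_one A p"
  define s where "s = pg_inv A p"
  have eA: "e \<in> A" using one_closed by (simp add: e_def)
  have "card (A - {e}) = 2" using card eA by simp
  then obtain a b where ab: "A - {e} = {a, b}" and "a \<noteq> b" by (auto simp: card_2_iff)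
  then have A: "A = {e, a, b}" and ne: "a \<noteq> e" "b \<noteq> e" "a \<noteq> b" using eA by auto
  note ne = ne ne[symmetric]
  obtain N d where p: "\<And>x y z. \<lbrakk>x \<in> A; y \<in> A; z \<in> A\<rbrakk> \<Longrightarrow> p x y z = fusion_prob N d x y z"
    and pos: "\<And>x. x \<in> A \<Longrightarrow> d x > 0" and de: "d e = 1" and ds: "\<And>x. x \<in> A \<Longrightarrow> d (s x) = d x"
    and dim: "\<And>x y. \<lbrakk>x \<in> A; y \<in> A\<rbrakk> \<Longrightarrow> (\<Sum>z\<in>A. N x y z * d z) = d x * d y"
    and ass: "\<And>x y z f. \<lbrakk>x \<in> A; y \<in> A; z \<in> A; f \<in> A\<rbrakk> \<Longrightarrow>
      (\<Sum>t\<in>A. N x y t * N t z f) = (\<Sum>t\<in>A. N x t f * N y z t)"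
    and unit1: "\<And>x y. \<lbrakk>x \<in> A; y \<in> A\<rbrakk> \<Longrightarrow> N e x y = of_bool (y = x)"
    and unit2: "\<And>x y. \<lbrakk>x \<in> A; y \<in> A\<rbrakk> \<Longrightarrow> N x e y = of_bool (y = x)"
    and dual: "\<And>x y. \<lbrakk>x \<in> A; y \<in> A\<rbrakk> \<Longrightarrow> N x y e = of_bool (y = s x)"
    and swap: "\<And>x y z. \<lbrakk>x \<in> A; y \<in> A; z \<in> A\<rbrakk> \<Longrightarrow> N x y z = N (s y) (s x) (s z)"
    using integral_fusion_ring[OF fin int] unfolding e_def s_def by blast
  have mem: "e \<in> A" "a \<in> A" "b \<in> A" using A by auto
  have sum3: "(\<Sum>z\<in>A. g z) = g e + g a + g b" for g :: "'a \<Rightarrow> nat"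
    unfolding A using ne by simp
  have se: "s e = e" using inv_one by (simp add: s_def e_def)
  have ss: "s (s x) = x" if "x \<in> A" for x using inv_inv that by (simp add: s_def)
  have sA: "s x \<in> A" if "x \<in> A" for x using inv_closed that by (simp add: s_def)
  define f where "f x y i = (if i = 0 then e else if i = 1 then x else y)" for x y and i :: nat
  have bij: "bij_betw (f a b) {0,1,2} A" "bij_betw (f b a) {0,1,2} A"
    using ne by (auto simp: bij_betw_def inj_on_def f_def A)
  have dims: "N x y e + N x y a * d a + N x y b * d b = d x * d y" if "x \<in> A" "y \<in> A" for x y
    using dim[OF that] de by (simp add: sum3)
  have units: "N e e e = 1" "N e e a = 0" "N e e b = 0" "N e a e = 0" "N e a a = 1" "N e a b = 0"
    "N e b e = 0" "N e b a = 0" "N e b b = 1" "N a e e = 0" "N a e a = 1" "N a e b = 0"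
    "N b e e = 0" "N b e a = 0" "N b e b = 1"
    using unit1 unit2 mem ne by auto
  have "s a \<noteq> e" using ss[OF mem(2)] se ne by metis
  then consider "s a = b" | "s a = a" using sA[OF mem(2)] A by auto
  then show ?thesis
  proof cases
    case 1
    then have sb: "s b = a" using ss[OF mem(2)] by simp
    have d_eq: "d b = d a" using ds[OF mem(2)] 1 by simp
    have duals: "N a a e = 0" "N a b e = 1" "N b a e = 1" "N b b e = 0"
      using dual mem 1 sb ne by auto
    have sw: "N b b b = N a a a" "N b b a = N a a b" "N a b b = N a b a" "N b a b = N b a a"
      using swap[of b b b] swap[of b b a] swap[of a b b] swap[of b a b] mem 1 sb by simp_all
    have ab: "d a = 1" "N a b a = 0"
      using dual_pair_dim[of "d a" "N a b a"] dims[of a b] pos[of a] mem duals sw d_eq by simp_all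
    have ba: "N b a a = 0"
      using dual_pair_dim[of "d a" "N b a a"] dims[of b a] pos[of a] mem duals sw d_eq by simp_all
    \<comment> \<open>So exactly one of \<open>aa = a\<close> and \<open>aa = b\<close> holds; the former contradicts \<open>(aa)b = a(ab) = a\<close>.\<close>
    have "N a a a + N a a b = 1"
      using dims[of a a] mem duals ab d_eq by simp
    moreover have "N a a a * N a b a + N a a b * N b b a = 1"
      using ass[of a a b a] mem units duals ab sw by (simp add: sum3)
    ultimately have aa: "N a a a = 0" "N a a b = 1" using ab sw by auto
    have "pg_isomorphic {0,1,2} cyclic_prob A p"
      by (rule fusion_table_iso[OF bij(1) p])
        (auto simp: f_def cyclic_table_def units duals sw ab ba aa d_eq de)
    then show ?thesis ..
  next
    case 2
    have sb: "s b = b"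
      using sA[OF mem(3)] ss[OF mem(2)] ss[OF mem(3)] 2 se ne A by auto
    have duals: "N a a e = 1" "N a b e = 0" "N b a e = 0" "N b b e = 1"
      using dual mem 2 sb ne by auto
    have comm: "N b a a = N a b a" "N b a b = N a b b"
      using swap[of b a a] swap[of b a b] mem 2 sb by simp_all
    \<comment> \<open>The coefficient of \<open>e\<close> in \<open>(aa)b = a(ab)\<close>; the next one is that in \<open>(bb)a = b(ba)\<close>.\<close>
    have y: "N a b a = N a a b"
      using ass[of a a b e] mem units duals by (simp add: sum3)
    have w: "N b b a = N a b b"
      using ass[of b b a e] mem units duals comm by (simp add: sum3)
    have "(d a = 1 \<and> d b = 2 \<and> N a a a = 0 \<and> N a a b = 0 \<and> N a b b = 1 \<and> N b b b = 1) \<or>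
      (d a = 2 \<and> d b = 1 \<and> N a a a = 1 \<and> N a a b = 1 \<and> N a b b = 0 \<and> N b b b = 0)"
      by (rule self_dual_dims)
        (use pos mem dims[of a a] dims[of a b] dims[of b b] duals y w in auto)
    then show ?thesis
    proof
      assume *: "d a = 1 \<and> d b = 2 \<and> N a a a = 0 \<and> N a a b = 0 \<and> N a b b = 1 \<and> N b b b = 1"
      have "pg_isomorphic {0,1,2} sym_prob A p"
        by (rule fusion_table_iso[OF bij(1) p])
          (use * in \<open>auto simp: f_def sym_table_def sym_dim_def units duals comm y w de\<close>)
      then show ?thesis ..
    next
      assume *: "d a = 2 \<and> d b = 1 \<and> N a a a = 1 \<and> N a a b = 1 \<and> N a b b = 0 \<and> N b b b = 0"
      have "pg_isomorphic {0,1,2} sym_prob A p"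
        by (rule fusion_table_iso[OF bij(2) p])
          (use * in \<open>auto simp: f_def sym_table_def sym_dim_def units duals comm y w de\<close>)
      then show ?thesis ..
    qed
  qed
qed

section \<open>Irreducible representations of small degree\<close>

lemma module_vec_subspace_iff:
  fixes W :: "'k::field vec set"
  shows "VectorSpace.subspace class_ring W (module_vec TYPE('k) n) \<longleftrightarrow>
    W \<subseteq> carrier_vec n \<and> 0\<^sub>v n \<in> W \<and> (\<forall>v\<in>W. \<forall>w\<in>W. v + w \<in> W) \<and>
    (\<forall>c. \<forall>v\<in>W. c \<cdot>\<^sub>v v \<in> W)"
  using vec_vs vec_module
  by (auto simp: VectorSpace.subspace_def submodule_def module_vec_simps)

text \<open>
  Subspaces spanned by at most two vectors are all that is needed to test irreducibility here;
  explicit linear combinations keep the invariance arguments short. Taking \<open>u = v\<close>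
  gives a line.
\<close>

definition span2 :: "'k::field vec \<Rightarrow> 'k vec \<Rightarrow> 'k vec set" where
  "span2 v u = {a \<cdot>\<^sub>v v + b \<cdot>\<^sub>v u | a b. True}"

lemma span2_subspace:
  fixes v :: "'k::field vec"
  assumes v: "v \<in> carrier_vec n" and u: "u \<in> carrier_vec n"
  shows "VectorSpace.subspace class_ring (span2 v u) (module_vec TYPE('k) n)"
  unfolding module_vec_subspace_iff
proof (intro conjI ballI allI)
  show "span2 v u \<subseteq> carrier_vec n" using v u by (auto simp: span2_def)
  have "0\<^sub>v n = 0 \<cdot>\<^sub>v v + 0 \<cdot>\<^sub>v u" using v u by auto
  then show "0\<^sub>v n \<in> span2 v u" unfolding span2_def by blast
next
  fix x y assume "x \<in> span2 v u" "y \<in> span2 v u"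
  then obtain a b c d where xy: "x = a \<cdot>\<^sub>v v + b \<cdot>\<^sub>v u" "y = c \<cdot>\<^sub>v v + d \<cdot>\<^sub>v u"
    by (auto simp: span2_def)
  have "x + y = (a + c) \<cdot>\<^sub>v v + (b + d) \<cdot>\<^sub>v u"
    using v u by (intro eq_vecI) (auto simp: xy algebra_simps)
  then show "x + y \<in> span2 v u" unfolding span2_def by blast
next
  fix c x assume "x \<in> span2 v u"
  then obtain a b where x: "x = a \<cdot>\<^sub>v v + b \<cdot>\<^sub>v u" by (auto simp: span2_def)
  have "c \<cdot>\<^sub>v x = (c * a) \<cdot>\<^sub>v v + (c * b) \<cdot>\<^sub>v u"
    using v u by (intro eq_vecI) (auto simp: x algebra_simps)
  then show "c \<cdot>\<^sub>v x \<in> span2 v u" unfolding span2_def by blast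
qed

lemma span2_invariant:
  fixes A :: "'k::field mat"
  assumes A: "A \<in> carrier_mat n n" and v: "v \<in> carrier_vec n" and u: "u \<in> carrier_vec n"
    and Av: "A *\<^sub>v v \<in> span2 v u" and Au: "A *\<^sub>v u \<in> span2 v u" and w: "w \<in> span2 v u"
  shows "A *\<^sub>v w \<in> span2 v u"
proof -
  obtain a b where w: "w = a \<cdot>\<^sub>v v + b \<cdot>\<^sub>v u" using w by (auto simp: span2_def)
  have "A *\<^sub>v w = a \<cdot>\<^sub>v (A *\<^sub>v v) + b \<cdot>\<^sub>v (A *\<^sub>v u)"
    using A v u by (simp add: w mult_add_distrib_mat_vec[of _ n n] mult_mat_vec[of _ n n])
  then show ?thesis
    using span2_subspace[OF v u] Av Au unfolding module_vec_subspace_iff by auto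
qed

lemma irreducible_span2:
  assumes irr: "irreducible_rep G n \<rho>"
    and v: "v \<in> carrier_vec n" "v \<noteq> 0\<^sub>v n" and u: "u \<in> carrier_vec n"
    and inv: "\<And>g w. \<lbrakk>g \<in> carrier G; w \<in> span2 v u\<rbrakk> \<Longrightarrow> \<rho> g *\<^sub>v w \<in> span2 v u"
  shows "span2 v u = carrier_vec n"
proof -
  have "v = 1 \<cdot>\<^sub>v v + 0 \<cdot>\<^sub>v u" using v u by auto
  then have "v \<in> span2 v u" unfolding span2_def by blast
  then show ?thesis
    using irr span2_subspace[OF v(1) u] inv v(2) unfolding irreducible_rep_def by blast
qed

text \<open>
  If the unit vectors are combinations of \<open>v\<close> and \<open>u\<close>, the identity
  matrix has rank at most two. Its upper left \<open>3 \<times> 3\<close> minor is therefore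
  both \<open>0\<close>, as a polynomial identity, and \<open>1\<close>.
\<close>

lemma span2_dim_le_2:
  fixes v :: "'k::field vec"
  assumes v: "v \<in> carrier_vec n" and u: "u \<in> carrier_vec n" and span: "span2 v u = carrier_vec n"
  shows "n \<le> 2"
proof (rule ccontr)
  assume "\<not> n \<le> 2"
  then have n: "0 < n" "1 < n" "2 < n" by auto
  have "\<exists>a b. unit_vec n i = a \<cdot>\<^sub>v v + b \<cdot>\<^sub>v u" for i :: nat
    using span unit_vec_carrier[of n i] unfolding span2_def by blast
  then obtain a b where ab: "\<And>i::nat. unit_vec n i = a i \<cdot>\<^sub>v v + b i \<cdot>\<^sub>v u" by metis
  have e: "a i * v $ j + b i * u $ j = of_bool (i = j)" if "i < n" "j < n" for i j
    using arg_cong[OF ab[of i], of "\<lambda>x. x $ j"] that v u by (auto simp: unit_vec_def)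
  note E = e[OF n(1) n(1)] e[OF n(1) n(2)] e[OF n(1) n(3)]
    e[OF n(2) n(1)] e[OF n(2) n(2)] e[OF n(2) n(3)]
    e[OF n(3) n(1)] e[OF n(3) n(2)] e[OF n(3) n(3)]
  define \<Delta> where "\<Delta> = (\<lambda>m :: nat \<Rightarrow> nat \<Rightarrow> 'k.
    m 0 0 * (m 1 1 * m 2 2 - m 1 2 * m 2 1) - m 0 1 * (m 1 0 * m 2 2 - m 1 2 * m 2 0)
    + m 0 2 * (m 1 0 * m 2 1 - m 1 1 * m 2 0))"
  have "\<Delta> (\<lambda>i j. a i * v $ j + b i * u $ j) = 0"
    unfolding \<Delta>_def by (simp add: algebra_simps)
  moreover have "\<Delta> (\<lambda>i j. a i * v $ j + b i * u $ j) = 1"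
    unfolding \<Delta>_def E by simp
  ultimately show False by simp
qed

text \<open>
  The line through a common eigenvector is invariant, hence the whole space.
\<close>

lemma irreducible_common_eigenvector:
  assumes irr: "irreducible_rep G n \<rho>"
    and v: "v \<in> carrier_vec n" "v \<noteq> 0\<^sub>v n"
    and ev: "\<And>g. g \<in> carrier G \<Longrightarrow> \<exists>k. \<rho> g *\<^sub>v v = k \<cdot>\<^sub>v v"
  shows "n = 1"
proof -
  have car: "\<rho> g \<in> carrier_mat n n" if "g \<in> carrier G" for g
    using irr that by (auto simp: irreducible_rep_def matrix_rep_def)
  have n: "n > 0" using irr by (simp add: irreducible_rep_def)
  have span: "span2 v v = carrier_vec n"
  proof (rule irreducible_span2[OF irr v v(1)])
    fix g w assume g: "g \<in> carrier G" and w: "w \<in> span2 v v"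
    obtain k where "\<rho> g *\<^sub>v v = k \<cdot>\<^sub>v v" using ev g by blast
    also have "\<dots> = k \<cdot>\<^sub>v v + 0 \<cdot>\<^sub>v v" using v by auto
    finally have "\<rho> g *\<^sub>v v \<in> span2 v v" unfolding span2_def by blast
    then show "\<rho> g *\<^sub>v w \<in> span2 v v"
      using span2_invariant car g v(1) w by blast
  qed
  have "\<not> 1 < n"
  proof
    assume n1: "1 < n"
    have "\<exists>a. unit_vec n i = a \<cdot>\<^sub>v v" for i
    proof -
      obtain a b where "unit_vec n i = a \<cdot>\<^sub>v v + b \<cdot>\<^sub>v v"
        using span unit_vec_carrier[of n i] unfolding span2_def by blast
      then have "unit_vec n i = (a + b) \<cdot>\<^sub>v v" by (simp add: add_smult_distrib_vec)
      then show ?thesis by blast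
    qed
    then obtain a where a: "\<And>i. unit_vec n i = a i \<cdot>\<^sub>v v" by metis
    have e: "a i * v $ j = of_bool (i = j)" if "i < n" "j < n" for i j
      using arg_cong[OF a[of i], of "\<lambda>x. x $ j"] that v by (auto simp: unit_vec_def)
    show False
      using e[OF n n] e[OF n n1] e[OF n1 n] e[OF n1 n1] by auto
  qed
  then show ?thesis using n by simp
qed

lemma matrix_repD:
  assumes "matrix_rep G n \<rho>"
  shows "g \<in> carrier G \<Longrightarrow> \<rho> g \<in> carrier_mat n n"
    and "\<rho> \<one>\<^bsub>G\<^esub> = 1\<^sub>m n"
    and "\<lbrakk>g \<in> carrier G; h \<in> carrier G\<rbrakk> \<Longrightarrow> \<rho> (g \<otimes>\<^bsub>G\<^esub> h) = \<rho> g * \<rho> h"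
  using assms unfolding matrix_rep_def by blast+

lemma exists_eigenvector:
  fixes A :: "'k::alg_closed_field mat"
  assumes A: "A \<in> carrier_mat n n" and n: "n > 0"
  obtains v k where "v \<in> carrier_vec n" "v \<noteq> 0\<^sub>v n" "A *\<^sub>v v = k \<cdot>\<^sub>v v"
proof -
  have "degree (char_poly A) > 0" using degree_monic_char_poly[OF A] n by simp
  then obtain k where "poly (char_poly A) k = 0" using alg_closed_imp_poly_has_root by blast
  then have "eigenvalue A k" using eigenvalue_root_char_poly[OF A] by simp
  then show ?thesis using that A unfolding eigenvalue_def eigenvector_def by auto
qed

lemma linear_character_irreducible:
  fixes \<mu> :: "'g \<Rightarrow> 'k::field"
  assumes "\<mu> \<one>\<^bsub>G\<^esub> = 1"
    and "\<And>g h. \<lbrakk>g \<in> carrier G; h \<in> carrier G\<rbrakk> \<Longrightarrow> \<mu> (g \<otimes>\<^bsub>G\<^esub> h) = \<mu> g * \<mu> h"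
  shows "restrict \<mu> (carrier G) \<in> irr_chars K G"
proof -
  define \<rho> where "\<rho> = (\<lambda>g. mat 1 1 (\<lambda>_. \<mu> g))"
  have "matrix_rep G 1 \<rho>"
    unfolding matrix_rep_def
    using assms by (auto simp: \<rho>_def scalar_prod_def intro!: eq_matI)
  moreover have "W = {0\<^sub>v 1} \<or> W = carrier_vec 1"
    if W: "VectorSpace.subspace class_ring W (module_vec TYPE('k) 1)" for W
  proof (cases "W = {0\<^sub>v 1}")
    case False
    then obtain w where w: "w \<in> W" "w \<noteq> 0\<^sub>v 1" "w \<in> carrier_vec 1"
      using W unfolding module_vec_subspace_iff by blast
    have w0: "w $ 0 \<noteq> 0" using w by (auto simp: vec_eq_iff)
    have "x \<in> W" if x: "x \<in> carrier_vec 1" for x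
    proof -
      have "x = (x $ 0 / w $ 0) \<cdot>\<^sub>v w" using x w w0 by (intro eq_vecI) auto
      then show ?thesis using W w(1) unfolding module_vec_subspace_iff by metis
    qed
    then show ?thesis using W unfolding module_vec_subspace_iff by blast
  qed simp
  ultimately have "irreducible_rep G 1 \<rho>" unfolding irreducible_rep_def by auto
  moreover have "rep_character G 1 \<rho> = restrict \<mu> (carrier G)"
    by (auto simp: rep_character_def \<rho>_def)
  ultimately show ?thesis unfolding irr_chars_def by (metis (mono_tags, lifting) mem_Collect_eq)
qed

lemma linear_characterE:
  fixes \<rho> :: "'g \<Rightarrow> 'k::field mat"
  assumes "matrix_rep G 1 \<rho>"
  obtains \<mu> where "\<mu> \<one>\<^bsub>G\<^esub> = 1"
    and "\<And>g h. \<lbrakk>g \<in> carrier G; h \<in> carrier G\<rbrakk> \<Longrightarrow> \<mu> (g \<otimes>\<^bsub>G\<^esub> h) = \<mu> g * \<mu> h"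
    and "rep_character G 1 \<rho> = restrict \<mu> (carrier G)"
proof
  let ?\<mu> = "\<lambda>g. \<rho> g $$ (0, 0)"
  show "?\<mu> \<one>\<^bsub>G\<^esub> = 1" using assms by (simp add: matrix_rep_def)
  show "?\<mu> (g \<otimes>\<^bsub>G\<^esub> h) = ?\<mu> g * ?\<mu> h" if "g \<in> carrier G" "h \<in> carrier G" for g h
  proof -
    have "\<rho> g \<in> carrier_mat 1 1" "\<rho> h \<in> carrier_mat 1 1" "\<rho> (g \<otimes>\<^bsub>G\<^esub> h) = \<rho> g * \<rho> h"
      using assms that by (auto simp: matrix_rep_def)
    then show ?thesis by (simp add: scalar_prod_def)
  qed
  show "rep_character G 1 \<rho> = restrict ?\<mu> (carrier G)"
    by (auto simp: rep_character_def)
qed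

section \<open>Reading off the probability group of a finite group\<close>

text \<open>
  Linear independence of the irreducible characters makes the decomposition of a product of
  characters unique, so the multiplicities can be read off any decomposition. It also makes
  \<open>chi\<close> injective. The structure of \<open>A(kG)\<close> is thus known once a list
  of the irreducible characters and a multiplication table for it are.
\<close>

lemma char_prob_fusion:
  fixes chi :: "'i \<Rightarrow> 'g \<Rightarrow> 'k::field_char_0"
  assumes fin: "finite I"
    and img: "chi ` I = irr_chars K G"
    and indep: "\<And>c. (\<And>g. g \<in> carrier G \<Longrightarrow> (\<Sum>k\<in>I. c k * chi k g) = 0) \<Longrightarrow> \<forall>k\<in>I. c k = 0"
    and mult: "\<And>i j g. \<lbrakk>i \<in> I; j \<in> I; g \<in> carrier G\<rbrakk> \<Longrightarrow>
      chi i g * chi j g = (\<Sum>k\<in>I. of_nat (N i j k) * chi k g)"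
    and deg: "\<And>i. i \<in> I \<Longrightarrow> chi i \<one>\<^bsub>G\<^esub> = of_nat (d i)"
  shows "pg_isomorphic I (fusion_prob N d) (irr_chars K G) (char_prob K G)"
proof -
  have inj: "inj_on chi I"
  proof (rule inj_onI, rule ccontr)
    fix i j assume ij: "i \<in> I" "j \<in> I" "chi i = chi j" "i \<noteq> j"
    \<comment> \<open>Equal characters \<open>chi i\<close> and \<open>chi j\<close> would give the linear relation \<open>chi i - chi j = 0\<close>.\<close>
    let ?c = "\<lambda>k. of_bool (k = i) - of_bool (k = j) :: 'k"
    have "(\<Sum>k\<in>I. ?c k * chi k g) = 0" for g
    proof -
      have "(\<Sum>k\<in>I. ?c k * chi k g) =
          (\<Sum>k\<in>I. (if k = i then chi i g else 0) - (if k = j then chi j g else 0))"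
        by (rule sum.cong) auto
      also have "\<dots> = 0" using ij fin by (simp add: sum_subtractf)
      finally show ?thesis .
    qed
    then have "\<forall>k\<in>I. ?c k = 0" by (rule indep)
    from bspec[OF this ij(1)] show False using ij by simp
  qed
  have bij: "bij_betw chi I (irr_chars K G)" using inj img by (simp add: bij_betw_def)
  have sum_irr: "(\<Sum>\<phi>\<in>irr_chars K G. f \<phi>) = (\<Sum>k\<in>I. f (chi k))" for f :: "('g \<Rightarrow> 'k) \<Rightarrow> 'k"
    by (rule sum.reindex_bij_betw[OF bij, symmetric])
  have mult_eq: "char_mult K G (chi i) (chi j) (chi k) = N i j k"
    if i: "i \<in> I" and j: "j \<in> I" and k: "k \<in> I" for i j k
  proof -
    define M where "M \<phi> = (if \<phi> \<in> irr_chars K G then N i j (inv_into I chi \<phi>) else 0)" for \<phi>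
    have M: "M (chi k) = N i j k" if "k \<in> I" for k
      using that inj img by (auto simp: M_def)
    have "char_mult K G (chi i) (chi j) = M"
      unfolding char_mult_def
    proof (rule the_equality)
      show "(\<forall>\<phi>. \<phi> \<notin> irr_chars K G \<longrightarrow> M \<phi> = 0) \<and>
        (\<forall>g\<in>carrier G. chi i g * chi j g = (\<Sum>\<phi>\<in>irr_chars K G. of_nat (M \<phi>) * \<phi> g))"
        unfolding sum_irr using mult[OF i j] M by (simp add: M_def)
    next
      fix M' assume M': "(\<forall>\<phi>. \<phi> \<notin> irr_chars K G \<longrightarrow> M' \<phi> = 0) \<and>
        (\<forall>g\<in>carrier G. chi i g * chi j g = (\<Sum>\<phi>\<in>irr_chars K G. of_nat (M' \<phi>) * \<phi> g))"
      have "(\<Sum>k\<in>I. (of_nat (M' (chi k)) - of_nat (N i j k)) * chi k g) = 0" if "g \<in> carrier G" for g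
        using M' that mult[OF i j that] unfolding sum_irr
        by (simp add: left_diff_distrib sum_subtractf)
      then have "\<forall>k\<in>I. of_nat (M' (chi k)) - of_nat (N i j k) = (0::'k)" by (rule indep)
      then have on_chi: "M' (chi k) = M (chi k)" if "k \<in> I" for k using that M by simp
      show "M' = M"
      proof
        fix \<phi>
        show "M' \<phi> = M \<phi>"
        proof (cases "\<phi> \<in> irr_chars K G")
          case True
          then obtain k where "k \<in> I" "\<phi> = chi k" using img by blast
          then show ?thesis using on_chi by simp
        next
          case False
          then show ?thesis using M' by (simp add: M_def)
        qed
      qed
    qed
    then show ?thesis using M k by simp
  qed
  have deg_eq: "char_degree G (chi i) = d i" if "i \<in> I" for i
    unfolding char_degree_def deg[OF that] by (rule the_equality) auto
  show ?thesis
    unfolding pg_isomorphic_def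
    using bij by (auto intro!: exI[of _ chi] simp: char_prob_def fusion_prob_def mult_eq deg_eq)
qed

section \<open>The characters of the cyclic group of order three\<close>

lemma primitive_cube_root_power_3:
  fixes \<omega> :: "'k::field"
  assumes "\<omega>\<^sup>2 + \<omega> + 1 = 0"
  shows "\<omega> ^ 3 = 1"
proof -
  have "\<omega> ^ 3 - 1 = (\<omega> - 1) * (\<omega>\<^sup>2 + \<omega> + 1)"
    by (simp add: algebra_simps power2_eq_square power3_eq_cube)
  then show ?thesis using assms by simp
qed

lemma exists_primitive_cube_root:
  obtains \<omega> :: "'k::alg_closed_field" where "\<omega>\<^sup>2 + \<omega> + 1 = 0"
proof -
  have "degree [:1, 1, 1 :: 'k:] > 0" by simp
  then obtain w :: 'k where "poly [:1, 1, 1:] w = 0"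
    using alg_closed_imp_poly_has_root by blast
  then have "w\<^sup>2 + w + 1 = 0" by (simp add: algebra_simps power2_eq_square)
  then show ?thesis by (rule that)
qed

lemma carrier_mod_3: "carrier (integer_mod_group 3) = {0, 1, 2}"
  by (auto simp: carrier_integer_mod_group)

definition cyclic_char :: "'k::field \<Rightarrow> nat \<Rightarrow> int \<Rightarrow> 'k" where
  "cyclic_char \<omega> i = (\<lambda>g \<in> carrier (integer_mod_group 3). (\<omega> ^ i) ^ nat g)"

lemma cyclic_char_values:
  "cyclic_char \<omega> i 0 = 1" "cyclic_char \<omega> i 1 = \<omega> ^ i" "cyclic_char \<omega> i 2 = (\<omega> ^ i)\<^sup>2"
  by (simp_all add: cyclic_char_def carrier_mod_3)

text \<open>
  An eigenvector of the matrix of the generator is an eigenvector of all matrices, so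
  irreducible representations have degree one. The value at the generator is a cube root of
  unity, that is, a power of \<open>\<omega>\<close>.
\<close>

lemma irr_chars_cyclic:
  fixes \<omega> :: "'k::{alg_closed_field, field_char_0}"
  assumes w: "\<omega>\<^sup>2 + \<omega> + 1 = 0"
  shows "cyclic_char \<omega> ` {0,1,2} = irr_chars (K :: 'k itself) (integer_mod_group 3)"
proof
  let ?G = "integer_mod_group 3"
  note w3 = primitive_cube_root_power_3[OF w]
  show "cyclic_char \<omega> ` {0,1,2} \<subseteq> irr_chars K ?G"
  proof
    fix \<chi> assume "\<chi> \<in> cyclic_char \<omega> ` {0,1,2}"
    then obtain i where i: "\<chi> = cyclic_char \<omega> i" by blast
    have z3: "(\<omega> ^ i) ^ 3 = 1" using w3 by (metis power_mult mult.commute power_one)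
    have "restrict (\<lambda>g. (\<omega> ^ i) ^ nat g) (carrier ?G) \<in> irr_chars K ?G"
    proof (rule linear_character_irreducible)
      fix g h assume "g \<in> carrier ?G" "h \<in> carrier ?G"
      then show "(\<omega> ^ i) ^ nat (g \<otimes>\<^bsub>?G\<^esub> h) = (\<omega> ^ i) ^ nat g * (\<omega> ^ i) ^ nat h"
        using z3 by (auto simp: carrier_mod_3 power2_eq_square power3_eq_cube mult.assoc)
    qed simp
    then show "\<chi> \<in> irr_chars K ?G" by (simp add: i cyclic_char_def)
  qed
  show "irr_chars K ?G \<subseteq> cyclic_char \<omega> ` {0,1,2}"
  proof
    fix \<chi> assume "\<chi> \<in> irr_chars K ?G"
    then obtain n and \<rho> :: "int \<Rightarrow> 'k mat"
      where irr: "irreducible_rep ?G n \<rho>" and \<chi>: "\<chi> = rep_character ?G n \<rho>"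
      unfolding irr_chars_def by blast
    have rep: "matrix_rep ?G n \<rho>" and n: "n > 0" using irr by (auto simp: irreducible_rep_def)
    have car: "\<rho> 0 \<in> carrier_mat n n" "\<rho> 1 \<in> carrier_mat n n" "\<rho> 2 \<in> carrier_mat n n"
      using matrix_repD(1)[OF rep] by (simp_all add: carrier_mod_3)
    have r0: "\<rho> 0 = 1\<^sub>m n" and r2: "\<rho> 2 = \<rho> 1 * \<rho> 1"
      using matrix_repD(2)[OF rep] matrix_repD(3)[OF rep, of 1 1]
      by (simp_all add: carrier_mod_3)
    obtain v k where v: "v \<in> carrier_vec n" "v \<noteq> 0\<^sub>v n" and ev: "\<rho> 1 *\<^sub>v v = k \<cdot>\<^sub>v v"
      using exists_eigenvector[OF car(2) n] by blast
    have "n = 1"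
    proof (rule irreducible_common_eigenvector[OF irr v])
      fix g assume "g \<in> carrier ?G"
      then consider "g = 0" | "g = 1" | "g = 2" by (auto simp: carrier_mod_3)
      then show "\<exists>k. \<rho> g *\<^sub>v v = k \<cdot>\<^sub>v v"
      proof cases
        case 1
        then have "\<rho> g *\<^sub>v v = 1 \<cdot>\<^sub>v v" using r0 v by simp
        then show ?thesis by blast
      next
        case 2
        then show ?thesis using ev by blast
      next
        case 3
        have "\<rho> g *\<^sub>v v = \<rho> 1 *\<^sub>v (k \<cdot>\<^sub>v v)"
          using 3 r2 ev v car assoc_mult_mat_vec[OF car(2) car(2) v(1)] by simp
        also have "\<dots> = k \<cdot>\<^sub>v (k \<cdot>\<^sub>v v)" using mult_mat_vec[OF car(2) v(1)] ev by simp
        also have "\<dots> = (k * k) \<cdot>\<^sub>v v" by (simp add: smult_smult_assoc)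
        finally show ?thesis by blast
      qed
    qed
    then obtain \<mu> where one: "\<mu> \<one>\<^bsub>?G\<^esub> = 1"
      and hom: "\<And>g h. \<lbrakk>g \<in> carrier ?G; h \<in> carrier ?G\<rbrakk> \<Longrightarrow> \<mu> (g \<otimes>\<^bsub>?G\<^esub> h) = \<mu> g * \<mu> h"
      and char: "rep_character ?G n \<rho> = restrict \<mu> (carrier ?G)"
      using linear_characterE rep by metis
    have m0: "\<mu> 0 = 1" using one by simp
    have m2: "\<mu> 2 = \<mu> 1 * \<mu> 1" using hom[of 1 1] by (simp add: carrier_mod_3)
    have m3: "\<mu> 1 * \<mu> 2 = 1" using hom[of 1 2] m0 by (simp add: carrier_mod_3)
    have sum: "\<omega> + \<omega>\<^sup>2 = -1" using w by (simp add: eq_neg_iff_add_eq_0 algebra_simps)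
    have "(\<mu> 1 - \<omega>) * (\<mu> 1 - \<omega>\<^sup>2) = \<mu> 1 * \<mu> 1 - \<mu> 1 * (\<omega> + \<omega>\<^sup>2) + \<omega> ^ 3"
      by (simp add: algebra_simps power2_eq_square power3_eq_cube)
    also have "\<dots> = \<mu> 1 * \<mu> 1 + \<mu> 1 + 1" unfolding sum w3 by simp
    finally have "(\<mu> 1 - 1) * ((\<mu> 1 - \<omega>) * (\<mu> 1 - \<omega>\<^sup>2)) = \<mu> 1 * (\<mu> 1 * \<mu> 1) - 1"
      by (simp add: algebra_simps)
    also have "\<dots> = 0" using m2 m3 by simp
    finally have "(\<mu> 1 - 1) * ((\<mu> 1 - \<omega>) * (\<mu> 1 - \<omega>\<^sup>2)) = 0" .
    then have "\<mu> 1 = \<omega> ^ 0 \<or> \<mu> 1 = \<omega> ^ 1 \<or> \<mu> 1 = \<omega> ^ 2" by auto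
    then obtain i where i: "i \<in> {0,1,2::nat}" "\<mu> 1 = \<omega> ^ i" by blast
    have "\<chi> = cyclic_char \<omega> i"
      unfolding \<chi> char cyclic_char_def
      by (rule restrict_ext) (use m0 m2 i in \<open>auto simp: carrier_mod_3 power2_eq_square\<close>)
    then show "\<chi> \<in> cyclic_char \<omega> ` {0,1,2}" using i by blast
  qed
qed

text \<open>
  Linear independence of the three characters is the invertibility of the matrix
  \<open>(\<omega>\<^sup>i\<^sup>j)\<close>, checked by elimination with
  \<open>\<omega>\<^sup>2 = -\<omega> - 1\<close>.
\<close>

lemma cyclic_char_prob:
  fixes K :: "'k::{alg_closed_field, field_char_0} itself"
  shows "pg_isomorphic {0,1,2} cyclic_prob
    (irr_chars K (integer_mod_group 3)) (char_prob K (integer_mod_group 3))"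
proof -
  obtain \<omega> :: 'k where w: "\<omega>\<^sup>2 + \<omega> + 1 = 0"
    by (rule exists_primitive_cube_root)
  note w3 = primitive_cube_root_power_3[OF w]
  show ?thesis
  proof (rule char_prob_fusion[OF finite_012 irr_chars_cyclic[OF w]])
    fix c :: "nat \<Rightarrow> 'k"
    assume "(\<Sum>k\<in>{0,1,2}. c k * cyclic_char \<omega> k g) = 0" if "g \<in> carrier (integer_mod_group 3)" for g
    note this[of 0] this[of 1] this[of 2]
    then have eqs: "c 0 + c 1 + c 2 = 0" "c 0 + c 1 * \<omega> + c 2 * \<omega>\<^sup>2 = 0"
      "c 0 + c 1 * \<omega>\<^sup>2 + c 2 * (\<omega>\<^sup>2)\<^sup>2 = 0"
      by (simp_all add: carrier_mod_3 cyclic_char_values add.assoc)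
    have w2: "\<omega>\<^sup>2 = - \<omega> - 1" using w by (simp add: eq_neg_iff_add_eq_0 algebra_simps)
    have w4: "(\<omega>\<^sup>2)\<^sup>2 = \<omega>"
    proof -
      have "(\<omega>\<^sup>2)\<^sup>2 = \<omega> ^ 3 * \<omega>" by (simp add: power2_eq_square power3_eq_cube)
      then show ?thesis using w3 by simp
    qed
    have "3 * c 0 = (c 0 + c 1 + c 2) + (c 0 + c 1 * \<omega> + c 2 * \<omega>\<^sup>2)
        + (c 0 + c 1 * \<omega>\<^sup>2 + c 2 * (\<omega>\<^sup>2)\<^sup>2)"
      unfolding w4 unfolding w2 by (simp add: algebra_simps)
    also have "\<dots> = 0" unfolding eqs by simp
    finally have c0: "c 0 = 0" by simp
    then have c2: "c 2 = - c 1" using eqs(1) by (simp add: eq_neg_iff_add_eq_0 add.commute)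
    have "c 1 * (2 * \<omega> + 1) = 0"
      using eqs(2) c0 c2 unfolding w2 by (simp add: algebra_simps)
    moreover have "(2 * \<omega> + 1)\<^sup>2 = 4 * (\<omega>\<^sup>2 + \<omega> + 1) - 3"
      by (simp add: algebra_simps power2_eq_square)
    then have "2 * \<omega> + 1 \<noteq> 0" using w by auto
    ultimately have "c 1 = 0" by simp
    then show "\<forall>k\<in>{0,1,2}. c k = 0" using c0 c2 by simp
  next
    fix i j :: nat and g :: int
    assume i: "i \<in> {0,1,2}" and j: "j \<in> {0,1,2}" and g: "g \<in> carrier (integer_mod_group 3)"
    have "cyclic_char \<omega> i g * cyclic_char \<omega> j g = cyclic_char \<omega> ((i + j) mod 3) g"
    proof -
      have red: "\<omega> ^ i * \<omega> ^ j = \<omega> ^ ((i + j) mod 3)"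
      proof -
        have "\<omega> ^ i * \<omega> ^ j = \<omega> ^ (3 * ((i + j) div 3) + (i + j) mod 3)"
          by (simp add: power_add)
        also have "\<dots> = \<omega> ^ ((i + j) mod 3)" by (simp only: power_add power_mult w3 power_one mult_1)
        finally show ?thesis .
      qed
      show ?thesis using g by (simp add: cyclic_char_def flip: power_mult_distrib red)
    qed
    also have "\<dots> = (\<Sum>k\<in>{0,1,2}. of_nat (cyclic_table i j k) * cyclic_char \<omega> k g)"
      using i j by (auto simp: cyclic_table_def)
    finally show "cyclic_char \<omega> i g * cyclic_char \<omega> j g =
      (\<Sum>k\<in>{0,1,2}. of_nat (cyclic_table i j k) * cyclic_char \<omega> k g)" .
  qed (simp add: cyclic_char_values)
qed

section \<open>Representations of the symmetric group on three letters\<close>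

definition rot :: "nat \<Rightarrow> nat" where
  "rot = transpose 1 2 \<circ> transpose 2 3"

definition flip :: "nat \<Rightarrow> nat" where
  "flip = transpose 1 2"

lemma rot_simps [simp]: "rot 1 = 2" "rot (Suc 0) = 2" "rot 2 = 3" "rot 3 = 1"
  by (simp_all add: rot_def transpose_def)

lemma flip_simps [simp]: "flip 1 = 2" "flip (Suc 0) = 2" "flip 2 = 1" "flip 3 = 3"
  by (simp_all add: flip_def transpose_def)

lemma rot_closed: "rot permutes {1..3}"
  unfolding rot_def by (intro permutes_compose permutes_swap_id) auto

lemma flip_closed: "flip permutes {1..3}"
  unfolding flip_def by (intro permutes_swap_id) auto

lemma permutes_3_eqI:
  assumes "p permutes {1..3::nat}" "q permutes {1..3}" "p 1 = q 1" "p 2 = q 2" "p 3 = q 3"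
  shows "p = q"
proof
  fix x :: nat
  show "p x = q x"
  proof (cases "x \<in> {1..3}")
    case True
    then have "x = 1 \<or> x = 2 \<or> x = 3" by auto
    then show ?thesis using assms by auto
  next
    case False
    then show ?thesis using assms by (simp add: permutes_not_in)
  qed
qed

definition sym3_elems :: "(nat \<Rightarrow> nat) set" where
  "sym3_elems = {id, rot, rot \<circ> rot, flip, flip \<circ> rot, flip \<circ> (rot \<circ> rot)}"

lemma carrier_sym_3: "carrier (sym_group 3) = sym3_elems"
proof
  have closed: "q permutes {1..3}" if "q \<in> sym3_elems" for q
    using that rot_closed flip_closed
    by (auto simp: sym3_elems_def permutes_id intro!: permutes_compose)
  then show "sym3_elems \<subseteq> carrier (sym_group 3)" by (auto simp: sym_group_carrier)
  show "carrier (sym_group 3) \<subseteq> sym3_elems"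
  proof
    fix p assume "p \<in> carrier (sym_group 3)"
    then have p: "p permutes {1..3}" by (simp add: sym_group_carrier)
    have r: "p i \<in> {1, 2, 3}" if "i \<in> {1, 2, 3}" for i
      using permutes_in_image[OF p, of i] that by auto
    have "p 1 \<noteq> p 2" "p 1 \<noteq> p 3" "p 2 \<noteq> p 3"
      by (simp_all add: inj_eq[OF permutes_inj[OF p]])
    moreover have "\<exists>q\<in>sym3_elems. x = q 1 \<and> y = q 2 \<and> z = q 3"
      if "x \<in> {1, 2, 3}" "y \<in> {1, 2, 3}" "z \<in> {1, 2, 3}" "x \<noteq> y" "x \<noteq> z" "y \<noteq> z"
      for x y z :: nat
      using that by (elim insertE emptyE; simp add: sym3_elems_def)
    ultimately have "\<exists>q\<in>sym3_elems. p 1 = q 1 \<and> p 2 = q 2 \<and> p 3 = q 3"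
      using r[of 1] r[of 2] r[of 3] by blast
    then obtain q where q: "q \<in> sym3_elems" "p 1 = q 1" "p 2 = q 2" "p 3 = q 3" by blast
    then have "p = q" using permutes_3_eqI[OF p closed] by blast
    then show "p \<in> sym3_elems" using q by simp
  qed
qed

text \<open>
  The dihedral relations, which every pair of representing matrices inherits.
\<close>

lemma sym3_relations: "rot \<circ> (rot \<circ> rot) = id" "flip \<circ> flip = id" "rot \<circ> flip = flip \<circ> (rot \<circ> rot)"
  by (rule permutes_3_eqI;
      (intro permutes_compose permutes_id rot_closed flip_closed | simp))+

lemma sym3_rep:
  fixes \<rho> :: "(nat \<Rightarrow> nat) \<Rightarrow> 'k::field mat"
  assumes rep: "matrix_rep (sym_group 3) n \<rho>"
  shows "\<rho> rot \<in> carrier_mat n n" "\<rho> flip \<in> carrier_mat n n" "\<rho> id = 1\<^sub>m n"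
    and "\<rho> (rot \<circ> rot) = \<rho> rot * \<rho> rot"
    and "\<rho> (flip \<circ> rot) = \<rho> flip * \<rho> rot"
    and "\<rho> (flip \<circ> (rot \<circ> rot)) = \<rho> flip * (\<rho> rot * \<rho> rot)"
    and "\<rho> rot * (\<rho> rot * \<rho> rot) = 1\<^sub>m n"
    and "\<rho> flip * \<rho> flip = 1\<^sub>m n"
    and "\<rho> rot * \<rho> flip = \<rho> flip * (\<rho> rot * \<rho> rot)"
proof -
  have mem: "rot \<in> carrier (sym_group 3)" "flip \<in> carrier (sym_group 3)"
    "rot \<circ> rot \<in> carrier (sym_group 3)"
    by (auto simp: carrier_sym_3 sym3_elems_def)
  note hom = matrix_repD(3)[OF rep, unfolded sym_group_mult]
  show "\<rho> rot \<in> carrier_mat n n" "\<rho> flip \<in> carrier_mat n n"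
    using matrix_repD(1)[OF rep] mem by auto
  show id: "\<rho> id = 1\<^sub>m n" using matrix_repD(2)[OF rep] by (simp add: sym_group_one)
  show rr: "\<rho> (rot \<circ> rot) = \<rho> rot * \<rho> rot"
    and "\<rho> (flip \<circ> rot) = \<rho> flip * \<rho> rot"
    using hom mem by blast+
  show frr: "\<rho> (flip \<circ> (rot \<circ> rot)) = \<rho> flip * (\<rho> rot * \<rho> rot)"
    using hom[OF mem(2,3)] rr by simp
  show "\<rho> rot * (\<rho> rot * \<rho> rot) = 1\<^sub>m n"
    using hom[OF mem(1,3)] rr id sym3_relations(1) by simp
  show "\<rho> flip * \<rho> flip = 1\<^sub>m n"
    using hom[OF mem(2,2)] id sym3_relations(2) by simp
  show "\<rho> rot * \<rho> flip = \<rho> flip * (\<rho> rot * \<rho> rot)"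
    using hom[OF mem(1,2)] frr sym3_relations(3) by simp
qed

lemma sym3_invariantI:
  fixes \<rho> :: "(nat \<Rightarrow> nat) \<Rightarrow> 'k::field mat"
  assumes rep: "matrix_rep (sym_group 3) n \<rho>" and W: "W \<subseteq> carrier_vec n"
    and rot: "\<And>w. w \<in> W \<Longrightarrow> \<rho> rot *\<^sub>v w \<in> W"
    and flip: "\<And>w. w \<in> W \<Longrightarrow> \<rho> flip *\<^sub>v w \<in> W"
    and g: "g \<in> carrier (sym_group 3)" and w: "w \<in> W"
  shows "\<rho> g *\<^sub>v w \<in> W"
proof -
  note R = sym3_rep[OF rep]
  have [simp]: "(A * B) *\<^sub>v w = A *\<^sub>v (B *\<^sub>v w)"
    if "A \<in> carrier_mat n n" "B \<in> carrier_mat n n" "w \<in> W" for A B w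
    using that W assoc_mult_mat_vec by blast
  have rr: "\<rho> rot * \<rho> rot \<in> carrier_mat n n" using R(1) by simp
  have "\<rho> id *\<^sub>v w = w" using R(3) w W by auto
  then show ?thesis
    using g w rot flip R(1,2) rr by (auto simp: carrier_sym_3 sym3_elems_def R(4-6))
qed

lemma sym3_common_eigenvector:
  fixes \<rho> :: "(nat \<Rightarrow> nat) \<Rightarrow> 'k::field mat"
  assumes irr: "irreducible_rep (sym_group 3) n \<rho>"
    and v: "v \<in> carrier_vec n" "v \<noteq> 0\<^sub>v n"
    and rot: "\<rho> rot *\<^sub>v v = a \<cdot>\<^sub>v v" and flip: "\<rho> flip *\<^sub>v v = b \<cdot>\<^sub>v v"
  shows "n = 1"
proof (rule irreducible_common_eigenvector[OF irr v])
  have rep: "matrix_rep (sym_group 3) n \<rho>" using irr by (simp add: irreducible_rep_def)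
  note R = sym3_rep[OF rep]
  let ?W = "{k \<cdot>\<^sub>v v | k. True}"
  fix g assume g: "g \<in> carrier (sym_group 3)"
  have "v = 1 \<cdot>\<^sub>v v" by simp
  then have vW: "v \<in> ?W" by blast
  have "\<rho> g *\<^sub>v v \<in> ?W"
  proof (rule sym3_invariantI[OF rep _ _ _ g vW])
    show "?W \<subseteq> carrier_vec n" using v by auto
    show "\<rho> rot *\<^sub>v w \<in> ?W" if w: "w \<in> ?W" for w
      using w R(1) v(1) by (auto simp: mult_mat_vec rot smult_smult_assoc)
    show "\<rho> flip *\<^sub>v w \<in> ?W" if w: "w \<in> ?W" for w
      using w R(2) v(1) by (auto simp: mult_mat_vec flip smult_smult_assoc)
  qed
  then show "\<exists>k. \<rho> g *\<^sub>v v = k \<cdot>\<^sub>v v" by blast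
qed

lemma vec_sum_zero_imp_neg:
  fixes v w :: "'k::field vec"
  assumes "v \<in> carrier_vec n" "w \<in> carrier_vec n" "v + w = 0\<^sub>v n"
  shows "w = (-1) \<cdot>\<^sub>v v"
proof (rule eq_vecI)
  fix i assume "i < dim_vec ((-1) \<cdot>\<^sub>v v)"
  then have i: "i < n" using assms by simp
  then have "v $ i + w $ i = 0" using assms index_add_vec(1)[of i w v] by simp
  then show "w $ i = ((-1) \<cdot>\<^sub>v v) $ i"
    using i assms by (simp add: eq_neg_iff_add_eq_0 add.commute)
qed (use assms in auto)

text \<open>
  If the rotation fixes \<open>w\<close>, it also fixes the image of \<open>w\<close> under the
  reflection, because the reflection inverts it. Then \<open>w + flip w\<close> is fixed by the
  whole group. If this vector vanishes, \<open>w\<close> itself is a common eigenvector on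
  which the reflection acts by \<open>-1\<close>.
\<close>

lemma sym3_rotation_fixed_vector:
  fixes \<rho> :: "(nat \<Rightarrow> nat) \<Rightarrow> 'k::field mat"
  assumes irr: "irreducible_rep (sym_group 3) n \<rho>"
    and w: "w \<in> carrier_vec n" "w \<noteq> 0\<^sub>v n" and fixed: "\<rho> rot *\<^sub>v w = w"
  shows "n = 1"
proof -
  have rep: "matrix_rep (sym_group 3) n \<rho>" using irr by (simp add: irreducible_rep_def)
  note R = sym3_rep[OF rep]
  let ?C = "\<rho> rot" and ?T = "\<rho> flip"
  have Tw: "?T *\<^sub>v w \<in> carrier_vec n" using R(2) w(1) by simp
  have TTw: "?T *\<^sub>v (?T *\<^sub>v w) = w"
    using assoc_mult_mat_vec[OF R(2) R(2) w(1)] R(8) w(1) by simp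
  have CTw: "?C *\<^sub>v (?T *\<^sub>v w) = ?T *\<^sub>v w"
  proof -
    have "?C *\<^sub>v (?T *\<^sub>v w) = (?T * (?C * ?C)) *\<^sub>v w"
      using assoc_mult_mat_vec[OF R(1) R(2) w(1)] R(9) by simp
    also have "\<dots> = ?T *\<^sub>v (?C *\<^sub>v (?C *\<^sub>v w))"
      using R(1,2) w(1) by (simp add: assoc_mult_mat_vec[of _ n n _ n])
    finally show ?thesis using fixed by simp
  qed
  show ?thesis
  proof (cases "w + ?T *\<^sub>v w = 0\<^sub>v n")
    case False
    have x: "w + ?T *\<^sub>v w \<in> carrier_vec n" using w Tw by simp
    have "?C *\<^sub>v (w + ?T *\<^sub>v w) = 1 \<cdot>\<^sub>v (w + ?T *\<^sub>v w)"
      using mult_add_distrib_mat_vec[OF R(1) w(1) Tw] fixed CTw by simp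
    moreover have "?T *\<^sub>v (w + ?T *\<^sub>v w) = 1 \<cdot>\<^sub>v (w + ?T *\<^sub>v w)"
      using mult_add_distrib_mat_vec[OF R(2) w(1) Tw] TTw comm_add_vec[OF w(1) Tw] by simp
    ultimately show ?thesis by (rule sym3_common_eigenvector[OF irr x False])
  next
    case True
    have "?T *\<^sub>v w = (-1) \<cdot>\<^sub>v w"
      using w(1) Tw True by (rule vec_sum_zero_imp_neg)
    moreover have "?C *\<^sub>v w = 1 \<cdot>\<^sub>v w" using fixed by simp
    ultimately show ?thesis using sym3_common_eigenvector[OF irr w] by blast
  qed
qed

text \<open>
  The reflection maps an eigenvector \<open>v\<close> of the rotation for the eigenvalue
  \<open>k\<close> to one for the eigenvalue \<open>k\<^sup>2\<close>, since it conjugates the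
  rotation to its square. Together with \<open>v\<close> the image spans an invariant subspace.
\<close>

lemma sym3_irreducible_dim:
  fixes \<rho> :: "(nat \<Rightarrow> nat) \<Rightarrow> 'k::alg_closed_field mat"
  assumes irr: "irreducible_rep (sym_group 3) n \<rho>"
  shows "n \<le> 2"
proof -
  have rep: "matrix_rep (sym_group 3) n \<rho>" and n: "n > 0"
    using irr by (auto simp: irreducible_rep_def)
  note R = sym3_rep[OF rep]
  let ?C = "\<rho> rot" and ?T = "\<rho> flip"
  obtain v k where v: "v \<in> carrier_vec n" "v \<noteq> 0\<^sub>v n" and Cv: "?C *\<^sub>v v = k \<cdot>\<^sub>v v"
    using exists_eigenvector[OF R(1) n] by blast
  define u where "u = ?T *\<^sub>v v"
  have u: "u \<in> carrier_vec n" using R(2) v by (simp add: u_def)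
  have Tu: "?T *\<^sub>v u = v"
    using assoc_mult_mat_vec[OF R(2) R(2) v(1)] R(8) v(1) by (simp add: u_def)
  have Cu: "?C *\<^sub>v u = (k * k) \<cdot>\<^sub>v u"
  proof -
    have "?C *\<^sub>v u = (?T * (?C * ?C)) *\<^sub>v v"
      using assoc_mult_mat_vec[OF R(1) R(2) v(1)] R(9) by (simp add: u_def)
    also have "\<dots> = ?T *\<^sub>v (?C *\<^sub>v (?C *\<^sub>v v))"
      using R(1,2) v(1) by (simp add: assoc_mult_mat_vec[of _ n n _ n])
    also have "\<dots> = (k * k) \<cdot>\<^sub>v u"
      using R(1,2) v(1) by (simp add: Cv mult_mat_vec[of _ n n] smult_smult_assoc u_def)
    finally show ?thesis .
  qed
  have in_span: "a \<cdot>\<^sub>v v \<in> span2 v u" "a \<cdot>\<^sub>v u \<in> span2 v u" for a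
  proof -
    have "a \<cdot>\<^sub>v v = a \<cdot>\<^sub>v v + 0 \<cdot>\<^sub>v u" "a \<cdot>\<^sub>v u = 0 \<cdot>\<^sub>v v + a \<cdot>\<^sub>v u" using v u by auto
    then show "a \<cdot>\<^sub>v v \<in> span2 v u" "a \<cdot>\<^sub>v u \<in> span2 v u" unfolding span2_def by blast+
  qed
  have "span2 v u = carrier_vec n"
  proof (rule irreducible_span2[OF irr v u])
    fix g w assume g: "g \<in> carrier (sym_group 3)" and w: "w \<in> span2 v u"
    show "\<rho> g *\<^sub>v w \<in> span2 v u"
    proof (rule sym3_invariantI[OF rep _ _ _ g w])
      show "span2 v u \<subseteq> carrier_vec n" using v u by (auto simp: span2_def)
      show "?C *\<^sub>v w \<in> span2 v u" if "w \<in> span2 v u" for w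
        using span2_invariant[OF R(1) v(1) u _ _ that] Cv Cu in_span by simp
      show "?T *\<^sub>v w \<in> span2 v u" if "w \<in> span2 v u" for w
        using span2_invariant[OF R(2) v(1) u _ _ that] Tu in_span[of 1] by (simp add: u_def)
    qed
  qed
  then show ?thesis using span2_dim_le_2[OF v(1) u] by simp
qed

lemma trace_mult_commute:
  fixes A B :: "'k::comm_semiring_0 mat"
  assumes "A \<in> carrier_mat n n" "B \<in> carrier_mat n n"
  shows "(\<Sum>i<n. (A * B) $$ (i, i)) = (\<Sum>i<n. (B * A) $$ (i, i))"
proof -
  have "(\<Sum>i<n. (A * B) $$ (i, i)) = (\<Sum>i<n. \<Sum>j<n. A $$ (i, j) * B $$ (j, i))"
    using assms by (auto simp: scalar_prod_def atLeast0LessThan intro!: sum.cong)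
  also have "\<dots> = (\<Sum>j<n. \<Sum>i<n. A $$ (i, j) * B $$ (j, i))" by (rule sum.swap)
  also have "\<dots> = (\<Sum>j<n. (B * A) $$ (j, j))"
    using assms by (auto simp: scalar_prod_def atLeast0LessThan mult.commute intro!: sum.cong)
  finally show ?thesis .
qed

text \<open>
  For a \<open>2 \<times> 2\<close> matrix with rows \<open>(p, q)\<close> and \<open>(r,
  s)\<close>, the equation \<open>S\<^sup>2 = 1\<close> contains \<open>(p + s) q = (p + s) r =
  0\<close> and \<open>p\<^sup>2 = s\<^sup>2\<close> once \<open>q = r = 0\<close>. So a
  non-zero trace makes \<open>S\<close> scalar.
\<close>

lemma involution_2_trace:
  fixes S :: "'k::field mat"
  assumes S: "S \<in> carrier_mat 2 2" and SS: "S * S = 1\<^sub>m 2"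
    and nonscalar: "\<And>c. S \<noteq> c \<cdot>\<^sub>m 1\<^sub>m 2"
  shows "(\<Sum>i<2. S $$ (i, i)) = 0"
proof (rule ccontr)
  define p q r s where "p = S $$ (0, 0)" and "q = S $$ (0, 1)" and "r = S $$ (1, 0)" and "s = S $$ (1, 1)"
  note defs = p_def q_def r_def s_def
  have ent: "(S * S) $$ (i, j) = S $$ (i, 0) * S $$ (0, j) + S $$ (i, 1) * S $$ (1, j)"
    if "i < 2" "j < 2" for i j
    using S that by (simp add: scalar_prod_def numeral_2_eq_2)
  have e: "p * p + q * r = 1" "p * q + q * s = 0" "r * p + s * r = 0" "r * q + s * s = 1"
    using ent[of 0 0] ent[of 0 1] ent[of 1 0] ent[of 1 1] by (simp_all add: SS defs)
  assume "(\<Sum>i<2. S $$ (i, i)) \<noteq> 0"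
  then have ps: "p + s \<noteq> 0" by (simp add: defs numeral_2_eq_2)
  have "q * (p + s) = 0" "r * (p + s) = 0" using e by (simp_all add: algebra_simps)
  then have qr: "q = 0" "r = 0" using ps by auto
  have "(p + s) * (p - s) = 0" using e qr by (simp add: algebra_simps)
  then have "p = s" using ps by simp
  then have "S = p \<cdot>\<^sub>m 1\<^sub>m 2"
    using S qr by (intro eq_matI) (auto simp: defs less_2_cases_iff)
  then show False using nonscalar by blast
qed

section \<open>The characters of the symmetric group on three letters\<close>

text \<open>
  The last character is that of the standard representation: the number of fixed points minus
  one.
\<close>

definition sym_char :: "nat \<Rightarrow> (nat \<Rightarrow> nat) \<Rightarrow> 'k::field" where
  "sym_char i = (\<lambda>g \<in> carrier (sym_group 3).
     if i = 0 then 1 else if i = 1 then of_int (sign g)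
     else of_bool (g 1 = 1) + of_bool (g 2 = 2) + of_bool (g 3 = 3) - 1)"

lemma sign_rot_flip: "sign rot = 1" "sign flip = -1"
  by (simp_all add: rot_def flip_def sign_compose permutation_swap_id sign_swap_id)

lemma sign_hom:
  assumes "g \<in> carrier (sym_group 3)" "h \<in> carrier (sym_group 3)"
  shows "sign (g \<circ> h) = sign g * sign h"
  using assms by (intro sign_compose) (auto intro: sym_group_carrier')

lemma sym3_sign_values:
  "sign (rot \<circ> rot) = 1" "sign (flip \<circ> rot) = -1" "sign (flip \<circ> (rot \<circ> rot)) = -1"
proof -
  have mem: "rot \<in> carrier (sym_group 3)" "flip \<in> carrier (sym_group 3)"
    "rot \<circ> rot \<in> carrier (sym_group 3)"
    by (auto simp: carrier_sym_3 sym3_elems_def)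
  show "sign (rot \<circ> rot) = 1" "sign (flip \<circ> rot) = -1" "sign (flip \<circ> (rot \<circ> rot)) = -1"
    using mem by (simp_all add: sign_hom sign_rot_flip)
qed

lemma sym_char_values:
  fixes i :: nat
  defines "\<chi> \<equiv> (sym_char i :: (nat \<Rightarrow> nat) \<Rightarrow> 'k::field)"
  shows "\<chi> id = (if i = 0 \<or> i = 1 then 1 else 2)"
    "\<chi> rot = (if i = 0 \<or> i = 1 then 1 else -1)"
    "\<chi> (rot \<circ> rot) = (if i = 0 \<or> i = 1 then 1 else -1)"
    "\<chi> flip = (if i = 0 then 1 else if i = 1 then -1 else 0)"
    "\<chi> (flip \<circ> rot) = (if i = 0 then 1 else if i = 1 then -1 else 0)"
    "\<chi> (flip \<circ> (rot \<circ> rot)) = (if i = 0 then 1 else if i = 1 then -1 else 0)"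
  by (auto simp: \<chi>_def sym_char_def carrier_sym_3 sym3_elems_def sign_rot_flip sym3_sign_values)

text \<open>
  The action on the vectors of coordinate sum zero, in the basis \<open>e\<^sub>1 -
  e\<^sub>3\<close>, \<open>e\<^sub>2 - e\<^sub>3\<close>. The offset \<open>+ 1\<close>
  translates matrix indices \<open>0, 1\<close> into points of \<open>{1, 2, 3}\<close>.
\<close>

definition std_rep :: "(nat \<Rightarrow> nat) \<Rightarrow> 'k::field mat" where
  "std_rep g = mat 2 2 (\<lambda>(i, j). of_bool (g (j + 1) = i + 1) - of_bool (g 3 = i + 1))"

lemma std_rep_hom:
  assumes "h permutes {1..3}"
  shows "std_rep (g \<circ> h) = (std_rep g * std_rep h :: 'k::field mat)"
proof (rule eq_matI)
  fix i j assume "i < dim_row (std_rep g * std_rep h :: 'k mat)" "j < dim_col (std_rep g * std_rep h :: 'k mat)"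
  then have ij: "i < 2" "j < 2" by (simp_all add: std_rep_def)
  have h: "h x \<in> {1, 2, 3}" if "x \<in> {1, 2, 3}" for x
    using permutes_in_image[OF assms, of x] that by auto
  \<comment> \<open>The image of \<open>e\<^sub>x - e\<^sub>y\<close>, expanded in the basis before applying \<open>g\<close>.\<close>
  have key: "of_bool (g x = i + 1) - of_bool (g y = i + 1) =
      (of_bool (g 1 = i + 1) - of_bool (g 3 = i + 1)) * (of_bool (x = 1) - of_bool (y = 1))
      + (of_bool (g 2 = i + 1) - of_bool (g 3 = i + 1)) * (of_bool (x = 2) - of_bool (y = 2) :: 'k)"
    if "x \<in> {1, 2, 3}" "y \<in> {1, 2, 3}" for x y
    using that by (elim insertE emptyE) (simp_all add: algebra_simps)
  have "j + 1 \<in> {1, 2, 3}" using ij by auto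
  note key = key[OF h[OF this] h[of 3]]
  have "(std_rep g * std_rep h :: 'k mat) $$ (i, j) =
      std_rep g $$ (i, 0) * std_rep h $$ (0, j) + std_rep g $$ (i, 1) * std_rep h $$ (1, j)"
    using ij by (simp add: std_rep_def scalar_prod_def numeral_2_eq_2)
  then show "std_rep (g \<circ> h) $$ (i, j) = (std_rep g * std_rep h :: 'k mat) $$ (i, j)"
    using ij key by (simp add: std_rep_def numeral_2_eq_2)
qed (simp_all add: std_rep_def)

lemma std_rep_matrix_rep: "matrix_rep (sym_group 3) 2 (std_rep :: _ \<Rightarrow> 'k::field mat)"
  unfolding matrix_rep_def sym_group_one sym_group_mult
proof (intro conjI ballI)
  show "std_rep g \<in> carrier_mat 2 2" for g by (simp add: std_rep_def)
  show "std_rep id = (1\<^sub>m 2 :: 'k mat)"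
    by (rule eq_matI) (auto simp: std_rep_def less_2_cases_iff)
  show "std_rep (g \<circ> h) = (std_rep g * std_rep h :: 'k mat)" if "h \<in> carrier (sym_group 3)" for g h
    using that by (simp add: std_rep_hom sym_group_carrier)
qed

text \<open>
  Cramer's rule.
\<close>

lemma subspace_2_eq_carrier:
  fixes W :: "'k::field vec set"
  assumes W: "VectorSpace.subspace class_ring W (module_vec TYPE('k) 2)"
    and v: "v \<in> W" and w: "w \<in> W"
    and det: "v $ 0 * w $ 1 - v $ 1 * w $ 0 \<noteq> 0"
  shows "W = carrier_vec 2"
proof
  note W = W[unfolded module_vec_subspace_iff]
  show "W \<subseteq> carrier_vec 2" using W by blast
  have vw: "v \<in> carrier_vec 2" "w \<in> carrier_vec 2" using W v w by auto
  show "carrier_vec 2 \<subseteq> W"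
  proof
    fix x :: "'k vec" assume x: "x \<in> carrier_vec 2"
    define D where "D = v $ 0 * w $ 1 - v $ 1 * w $ 0"
    have D: "D \<noteq> 0" using det by (simp add: D_def)
    define a b where "a = (x $ 0 * w $ 1 - x $ 1 * w $ 0) / D"
      and "b = (v $ 0 * x $ 1 - v $ 1 * x $ 0) / D"
    have "a * v $ 0 + b * w $ 0 = x $ 0 * D / D"
      unfolding a_def b_def D_def by (simp add: algebra_simps flip: add_divide_distrib)
    moreover have "a * v $ 1 + b * w $ 1 = x $ 1 * D / D"
      unfolding a_def b_def D_def by (simp add: algebra_simps flip: add_divide_distrib)
    ultimately have "x = a \<cdot>\<^sub>v v + b \<cdot>\<^sub>v w"
      using x vw D by (intro eq_vecI) (auto simp: less_2_cases_iff)
    then show "x \<in> W" using W v w by simp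
  qed
qed

text \<open>
  A proper invariant subspace contains no two independent vectors. So for \<open>w = (x,
  y)\<close> in it, both \<open>w, rot w\<close> and \<open>w, flip w\<close> are dependent,
  which means \<open>x\<^sup>2 + xy + y\<^sup>2 = 0\<close> and \<open>x\<^sup>2 =
  y\<^sup>2\<close>. In characteristic zero the only solution is \<open>w = 0\<close>.
\<close>

lemma std_rep_irreducible:
  "irreducible_rep (sym_group 3) 2 (std_rep :: _ \<Rightarrow> 'k::field_char_0 mat)"
  unfolding irreducible_rep_def
proof (intro conjI allI impI)
  fix W :: "'k vec set"
  assume asm: "VectorSpace.subspace class_ring W (module_vec TYPE('k) 2) \<and>
    (\<forall>g\<in>carrier (sym_group 3). \<forall>w\<in>W. std_rep g *\<^sub>v w \<in> W)"
  then have W: "VectorSpace.subspace class_ring W (module_vec TYPE('k) 2)"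
    and inv: "\<And>g w. \<lbrakk>g \<in> carrier (sym_group 3); w \<in> W\<rbrakk> \<Longrightarrow> std_rep g *\<^sub>v w \<in> W" by auto
  show "W = {0\<^sub>v 2} \<or> W = carrier_vec 2"
  proof (rule disjCI)
    assume nW: "W \<noteq> carrier_vec 2"
    have "w = 0\<^sub>v 2" if w: "w \<in> W" for w
    proof -
      have wc: "w \<in> carrier_vec 2" using W w unfolding module_vec_subspace_iff by blast
      define x y where "x = w $ 0" and "y = w $ 1"
      have mem: "rot \<in> carrier (sym_group 3)" "flip \<in> carrier (sym_group 3)"
        using rot_closed flip_closed by (simp_all only: sym_group_carrier)
      have rot: "(std_rep rot *\<^sub>v w) $ 0 = - x - y" "(std_rep rot *\<^sub>v w) $ 1 = x"
        and flip: "(std_rep flip *\<^sub>v w) $ 0 = y" "(std_rep flip *\<^sub>v w) $ 1 = x"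
        using wc rot_simps(3) flip_simps(3)
        by (simp_all add: std_rep_def scalar_prod_def numeral_2_eq_2 x_def y_def)
      have "x * x - y * (- x - y) = 0" "x * x - y * y = 0"
        using subspace_2_eq_carrier[OF W w inv[OF mem(1) w]]
          subspace_2_eq_carrier[OF W w inv[OF mem(2) w]] nW
        unfolding rot flip x_def[symmetric] y_def[symmetric] by blast+
      then have "x * x + x * y + y * y = 0" "(x - y) * (x + y) = 0"
        by (simp_all add: algebra_simps)
      then have "x = 0 \<and> y = 0"
      proof -
        assume q: "x * x + x * y + y * y = 0" and "(x - y) * (x + y) = 0"
        then have "x = y \<or> x = - y" by (auto simp: eq_neg_iff_add_eq_0)
        then show ?thesis
        proof
          assume "x = y"
          then have "3 * (y * y) = 0" using q by simp
          then show ?thesis using \<open>x = y\<close> by simp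
        next
          assume "x = - y"
          then show ?thesis using q by simp
        qed
      qed
      then show ?thesis using wc by (intro eq_vecI) (auto simp: less_2_cases_iff x_def y_def)
    qed
    then show "W = {0\<^sub>v 2}" using W unfolding module_vec_subspace_iff by blast
  qed
qed (simp_all add: std_rep_matrix_rep)

lemma std_rep_character:
  "rep_character (sym_group 3) 2 (std_rep :: _ \<Rightarrow> 'k::field mat) = sym_char 2"
  unfolding rep_character_def sym_char_def
proof (rule restrict_ext)
  fix g assume "g \<in> carrier (sym_group 3)"
  then have "g 3 \<in> {1, 2, 3}"
    using permutes_in_image[of g "{1..3}" 3] by (auto simp: sym_group_carrier)
  then show "(\<Sum>i<2. std_rep g $$ (i, i)) = (if (2::nat) = 0 then 1 else if (2::nat) = 1 then of_int (sign g)
     else of_bool (g 1 = 1) + of_bool (g 2 = 2) + of_bool (g 3 = 3) - 1 :: 'k)"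
    by (elim insertE emptyE) (simp_all add: std_rep_def numeral_2_eq_2)
qed

text \<open>
  In degree one the matrices commute, so the relation \<open>rot flip = flip
  rot\<^sup>2\<close> makes the rotation trivial, and the reflection becomes a sign.
\<close>

lemma sym3_character_1:
  fixes \<rho> :: "(nat \<Rightarrow> nat) \<Rightarrow> 'k::field mat"
  assumes rep: "matrix_rep (sym_group 3) 1 \<rho>"
  shows "rep_character (sym_group 3) 1 \<rho> \<in> sym_char ` {0, 1}"
proof -
  obtain \<mu> where one: "\<mu> \<one>\<^bsub>sym_group 3\<^esub> = 1"
    and hom: "\<And>g h. \<lbrakk>g \<in> carrier (sym_group 3); h \<in> carrier (sym_group 3)\<rbrakk> \<Longrightarrow>
      \<mu> (g \<otimes>\<^bsub>sym_group 3\<^esub> h) = \<mu> g * \<mu> h"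
    and char: "rep_character (sym_group 3) 1 \<rho> = restrict \<mu> (carrier (sym_group 3))"
    using linear_characterE[OF rep] by blast
  note hom = hom[unfolded sym_group_mult]
  have mem: "rot \<in> carrier (sym_group 3)" "flip \<in> carrier (sym_group 3)"
    "rot \<circ> rot \<in> carrier (sym_group 3)"
    by (auto simp: carrier_sym_3 sym3_elems_def)
  have id: "\<mu> id = 1" using one by (simp add: sym_group_one)
  have rr: "\<mu> (rot \<circ> rot) = \<mu> rot * \<mu> rot" using hom mem by blast
  have fr: "\<mu> (flip \<circ> rot) = \<mu> flip * \<mu> rot" using hom mem by blast
  have frr: "\<mu> (flip \<circ> (rot \<circ> rot)) = \<mu> flip * (\<mu> rot * \<mu> rot)"
    using hom[OF mem(2,3)] rr by simp
  have cube: "\<mu> rot * (\<mu> rot * \<mu> rot) = 1" using hom[OF mem(1,3)] rr id sym3_relations(1) by simp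
  have sq: "\<mu> flip * \<mu> flip = 1" using hom[OF mem(2,2)] id sym3_relations(2) by simp
  have rel: "\<mu> rot * \<mu> flip = \<mu> flip * (\<mu> rot * \<mu> rot)"
    using hom[OF mem(1,2), unfolded sym3_relations(3) frr] by (rule sym)
  have "(\<mu> flip * \<mu> rot) * (\<mu> rot - 1) = \<mu> flip * (\<mu> rot * \<mu> rot) - \<mu> rot * \<mu> flip"
    by (simp add: algebra_simps)
  also have "\<dots> = 0" unfolding rel by simp
  finally have "(\<mu> flip * \<mu> rot) * (\<mu> rot - 1) = 0" .
  moreover have "\<mu> flip \<noteq> 0" "\<mu> rot \<noteq> 0" using sq cube by auto
  ultimately have r: "\<mu> rot = 1" by simp
  have "(\<mu> flip - 1) * (\<mu> flip + 1) = 0" using sq by (simp add: algebra_simps)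
  then have "\<mu> flip = 1 \<or> \<mu> flip = -1" by (auto simp: eq_neg_iff_add_eq_0)
  moreover define i :: nat where "i = (if \<mu> flip = 1 then 0 else 1)"
  ultimately have i: "i \<in> {0, 1}" "\<mu> flip = (if i = 0 then 1 else -1)" by auto
  have char_i: "restrict \<mu> (carrier (sym_group 3)) = sym_char i"
  proof
    fix g
    show "restrict \<mu> (carrier (sym_group 3)) g = sym_char i g"
    proof (cases "g \<in> carrier (sym_group 3)")
      case True
      then have "g \<in> sym3_elems" by (simp add: carrier_sym_3)
      then have "\<mu> g = sym_char i g"
        unfolding sym3_elems_def using i r
        by (elim insertE emptyE) (auto simp: sym_char_values id rr fr frr)
      then show ?thesis using True by simp
    qed (simp add: sym_char_def)
  qed
  show ?thesis unfolding char char_i using i(1) by (rule imageI)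
qed

text \<open>
  Let \<open>C\<close> be the matrix of the rotation. The columns of \<open>1 + C +
  C\<^sup>2\<close> are fixed by \<open>C\<close>, hence zero, as a fixed vector would force
  degree one. As \<open>C\<close> and \<open>C\<^sup>2\<close> are conjugate, taking traces
  gives \<open>2 + 2 tr C = 0\<close>. Every reflection \<open>S\<close> satisfies \<open>CS =
  SC\<^sup>2\<close>; if it were a scalar, this would give \<open>C = C\<^sup>2\<close> and
  thus \<open>C = 1\<close>, again with fixed vectors. So \<open>S\<close> is a non-scalar
  involution and has trace zero.
\<close>

lemma sym3_character_2:
  fixes \<rho> :: "(nat \<Rightarrow> nat) \<Rightarrow> 'k::{alg_closed_field, field_char_0} mat"
  assumes irr: "irreducible_rep (sym_group 3) 2 \<rho>"
  shows "rep_character (sym_group 3) 2 \<rho> = sym_char 2"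
proof -
  have rep: "matrix_rep (sym_group 3) 2 \<rho>" using irr by (simp add: irreducible_rep_def)
  note R = sym3_rep[OF rep]
  let ?C = "\<rho> rot" and ?T = "\<rho> flip"
  let ?tr = "\<lambda>A :: 'k mat. \<Sum>i<2. A $$ (i, i)"
  have nofix: "w = 0\<^sub>v 2" if "w \<in> carrier_vec 2" "?C *\<^sub>v w = w" for w
    using sym3_rotation_fixed_vector[OF irr that(1) _ that(2)] by auto
  have CC: "?C * ?C \<in> carrier_mat 2 2" using R(1) by simp
  have norm: "1\<^sub>m 2 + ?C + ?C * ?C = 0\<^sub>m 2 2"
  proof -
    define M where "M = 1\<^sub>m 2 + ?C + ?C * ?C"
    have M: "M \<in> carrier_mat 2 2" using R(1) by (simp add: M_def)
    have "?C * M = ?C + ?C * ?C + 1\<^sub>m 2"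
      unfolding M_def using R(1,7) CC by (simp add: mult_add_distrib_mat[of _ 2 2 _ 2])
    also have "\<dots> = M"
      unfolding M_def using R(1) CC by (intro eq_matI) auto
    finally have CM: "?C * M = M" .
    have col0: "col M j = 0\<^sub>v 2" if "j < 2" for j
    proof (rule nofix)
      show "col M j \<in> carrier_vec 2" by (rule carrier_vecI) (use M in simp)
      show "?C *\<^sub>v col M j = col M j" using col_mult2[OF R(1) M that] CM by simp
    qed
    have "M = 0\<^sub>m 2 2"
    proof (rule eq_matI)
      fix i j :: nat
      assume "i < dim_row (0\<^sub>m 2 2 :: 'k mat)" "j < dim_col (0\<^sub>m 2 2 :: 'k mat)"
      then have ij: "i < 2" "j < 2" by simp_all
      have "col M j $ i = M $$ (i, j)" using M ij by simp
      then show "M $$ (i, j) = 0\<^sub>m 2 2 $$ (i, j)" using col0[OF ij(2)] ij by simp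
    qed (use M in auto)
    then show ?thesis by (simp add: M_def)
  qed
  have "?tr (1\<^sub>m 2 + ?C + ?C * ?C) = 0" unfolding norm by simp
  then have sum0: "2 + ?tr ?C + ?tr (?C * ?C) = 0"
    using R(1) CC by (simp add: numeral_2_eq_2 algebra_simps)
  have TC: "?T * ?C \<in> carrier_mat 2 2" "?C * ?T \<in> carrier_mat 2 2"
    "?T * (?C * ?C) \<in> carrier_mat 2 2" using R(1,2) by simp_all
  have trCC: "?tr (?C * ?C) = ?tr ?C"
  proof -
    have "?T * (?C * ?T) = ?C * ?C"
    proof -
      have "?T * (?C * ?T) = (?T * ?T) * (?C * ?C)"
        using R(1,2) CC by (simp add: R(9) assoc_mult_mat[of _ 2 2 _ 2 _ 2])
      then show ?thesis using R(8) left_mult_one_mat[OF CC] by simp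
    qed
    then have "?tr (?C * ?C) = ?tr (?T * (?C * ?T))" by simp
    also have "\<dots> = ?tr ((?C * ?T) * ?T)" by (rule trace_mult_commute[OF R(2) TC(2)])
    also have "(?C * ?T) * ?T = ?C"
      using R(1,2,8) by (simp add: assoc_mult_mat[of _ 2 2 _ 2 _ 2])
    finally show ?thesis .
  qed
  have trC: "?tr ?C = -1"
  proof -
    have "2 * (?tr ?C + 1) = 0" using sum0 trCC by (simp add: algebra_simps)
    then have "?tr ?C + 1 = 0" unfolding mult_eq_0_iff by simp
    then show ?thesis by (simp add: eq_neg_iff_add_eq_0)
  qed
  have reflection: "?tr S = 0"
    if S: "S \<in> carrier_mat 2 2" and SS: "S * S = 1\<^sub>m 2" and CS: "?C * S = S * (?C * ?C)" for S
  proof (rule involution_2_trace[OF S SS])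
    fix c show "S \<noteq> c \<cdot>\<^sub>m 1\<^sub>m 2"
    proof
      assume Sc: "S = c \<cdot>\<^sub>m 1\<^sub>m 2"
      have c: "c \<noteq> 0"
      proof
        assume "c = 0"
        then have "(S * S) $$ (0, 0) = 0" by (simp add: Sc scalar_prod_def)
        then show False using SS by simp
      qed
      have "c \<cdot>\<^sub>m ?C = ?C * S"
        using mult_smult_distrib[OF R(1) one_carrier_mat] right_mult_one_mat[OF R(1)] by (simp add: Sc)
      also have "\<dots> = c \<cdot>\<^sub>m (?C * ?C)"
        unfolding CS using mult_smult_assoc_mat[OF one_carrier_mat CC] left_mult_one_mat[OF CC]
        by (simp add: Sc)
      finally have eq: "c \<cdot>\<^sub>m ?C = c \<cdot>\<^sub>m (?C * ?C)" .
      have CCC: "?C = ?C * ?C"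
      proof (rule eq_matI)
        fix i j assume ij: "i < dim_row (?C * ?C)" "j < dim_col (?C * ?C)"
        then have "c * ?C $$ (i, j) = c * (?C * ?C) $$ (i, j)"
          using arg_cong[OF eq, of "\<lambda>A. A $$ (i, j)"] R(1) CC by simp
        then show "?C $$ (i, j) = (?C * ?C) $$ (i, j)" using c by simp
      qed (use R(1) in auto)
      then have "?C = 1\<^sub>m 2" using R(7) by metis
      then have "?C *\<^sub>v unit_vec 2 0 = unit_vec 2 0" by simp
      then have "unit_vec 2 0 = (0\<^sub>v 2 :: 'k vec)" using nofix by simp
      then show False by simp
    qed
  qed
  have CTC: "?C * (?T * ?C) = ?T"
  proof -
    have "?C * (?T * ?C) = (?C * ?T) * ?C" by (rule assoc_mult_mat[OF R(1,2,1), symmetric])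
    also have "\<dots> = ?T * ((?C * ?C) * ?C)" unfolding R(9) by (rule assoc_mult_mat[OF R(2) CC R(1)])
    also have "(?C * ?C) * ?C = 1\<^sub>m 2" using assoc_mult_mat[OF R(1,1,1)] R(7) by simp
    finally show ?thesis using right_mult_one_mat[OF R(2)] by simp
  qed
  have trT: "?tr ?T = 0" by (rule reflection[OF R(2,8,9)])
  have trTC: "?tr (?T * ?C) = 0"
  proof (rule reflection[OF TC(1)])
    show "?T * ?C * (?T * ?C) = 1\<^sub>m 2"
      using assoc_mult_mat[OF R(2,1) TC(1)] CTC R(8) by simp
    have "?T * ?C * (?C * ?C) = ?T"
      using assoc_mult_mat[OF R(2,1) CC] R(7) right_mult_one_mat[OF R(2)] by simp
    then show "?C * (?T * ?C) = ?T * ?C * (?C * ?C)" using CTC by simp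
  qed
  have trTCC: "?tr (?T * (?C * ?C)) = 0"
    using trace_mult_commute[OF R(1,2)] trTC R(9) by simp
  show ?thesis
  proof
    fix g
    show "rep_character (sym_group 3) 2 \<rho> g = sym_char 2 g"
    proof (cases "g \<in> carrier (sym_group 3)")
      case True
      then have "g \<in> sym3_elems" by (simp add: carrier_sym_3)
      moreover have "?tr (1\<^sub>m 2) = 2" by (simp add: numeral_2_eq_2)
      ultimately have "?tr (\<rho> g) = sym_char 2 g"
        unfolding sym3_elems_def
        by (elim insertE emptyE)
          (simp_all only: R(3-6) trC trCC trT trTC trTCC sym_char_values, simp_all)
      then show ?thesis using True by (simp add: rep_character_def)
    qed (simp add: sym_char_def rep_character_def)
  qed
qed

lemma irr_chars_sym:
  fixes K :: "'k::{alg_closed_field, field_char_0} itself"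
  shows "sym_char ` {0, 1, 2} = irr_chars K (sym_group 3)"
proof
  show "irr_chars K (sym_group 3) \<subseteq> sym_char ` {0, 1, 2}"
  proof
    fix \<chi> assume "\<chi> \<in> irr_chars K (sym_group 3)"
    then obtain n and \<rho> :: "(nat \<Rightarrow> nat) \<Rightarrow> 'k mat"
      where irr: "irreducible_rep (sym_group 3) n \<rho>" and \<chi>: "\<chi> = rep_character (sym_group 3) n \<rho>"
      unfolding irr_chars_def by blast
    have n0: "n > 0" and rep: "matrix_rep (sym_group 3) n \<rho>"
      using irr by (auto simp: irreducible_rep_def)
    have "n \<le> 2" by (rule sym3_irreducible_dim[OF irr])
    then consider "n = 1" | "n = 2" using n0 by linarith
    then show "\<chi> \<in> sym_char ` {0, 1, 2}"
    proof cases
      case 1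
      then show ?thesis using sym3_character_1 rep \<chi> by blast
    next
      case 2
      then show ?thesis using sym3_character_2 irr \<chi> by blast
    qed
  qed
  have "sym_char 0 \<in> irr_chars K (sym_group 3)"
    using linear_character_irreducible[of "\<lambda>_. 1" "sym_group 3" K] by (simp add: sym_char_def)
  moreover have "sym_char 1 \<in> irr_chars K (sym_group 3)"
    using linear_character_irreducible[of "\<lambda>g. of_int (sign g)" "sym_group 3" K]
    by (simp add: sym_char_def sign_hom sym_group_one sym_group_mult)
  moreover have "sym_char 2 \<in> irr_chars K (sym_group 3)"
    unfolding irr_chars_def using std_rep_irreducible std_rep_character by (metis (mono_tags, lifting) mem_Collect_eq)
  ultimately show "sym_char ` {0, 1, 2} \<subseteq> irr_chars K (sym_group 3)" by blast
qed

lemma sym_char_prob: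
  fixes K :: "'k::{alg_closed_field, field_char_0} itself"
  shows "pg_isomorphic {0,1,2} sym_prob (irr_chars K (sym_group 3)) (char_prob K (sym_group 3))"
proof (rule char_prob_fusion[OF finite_012 irr_chars_sym])
  fix c :: "nat \<Rightarrow> 'k"
  assume "(\<Sum>k\<in>{0,1,2}. c k * sym_char k g) = 0" if "g \<in> carrier (sym_group 3)" for g
  note this[of id] this[of rot] this[of flip]
  then have id: "c 0 + c 1 + 2 * c 2 = 0" and rot: "c 0 + c 1 - c 2 = 0" and flip: "c 0 - c 1 = 0"
    by (simp_all add: carrier_sym_3 sym3_elems_def sym_char_values algebra_simps)
  have "3 * c 2 = (c 0 + c 1 + 2 * c 2) - (c 0 + c 1 - c 2)" by simp
  then have c2: "c 2 = 0" unfolding id rot by simp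
  have c01: "c 0 = c 1" using flip by simp
  then have "2 * c 1 = 0" using rot c2 by (simp only: diff_0_right mult_2)
  then have "c 1 = 0" by simp
  then show "\<forall>k\<in>{0,1,2}. c k = 0" using c2 c01 by simp
next
  fix i j :: nat and g :: "nat \<Rightarrow> nat"
  assume i: "i \<in> {0,1,2}" and j: "j \<in> {0,1,2}" and g: "g \<in> carrier (sym_group 3)"
  have "g \<in> sym3_elems" using g by (simp add: carrier_sym_3)
  then show "sym_char i g * sym_char j g =
      (\<Sum>k\<in>{0,1,2}. of_nat (sym_table i j k) * sym_char k g :: 'k)"
    unfolding sym3_elems_def using i j
    by (elim insertE emptyE) (simp_all add: sym_char_values sym_table_def)
qed (auto simp: sym_group_one sym_char_values sym_dim_def)

section \<open>The \<open>2\<close>-integral probability groups with three elements\<close>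

theorem proposition6p3:
  fixes K :: "'k::{alg_closed_field, field_char_0} itself"
  shows
    "(prob_group (irr_chars K (sym_group 3)) (char_prob K (sym_group 3)) \<and>
      card (irr_chars K (sym_group 3)) = 3 \<and>
      pg_integral 2 (irr_chars K (sym_group 3)) (char_prob K (sym_group 3))) \<and>
     (prob_group (irr_chars K (integer_mod_group 3)) (char_prob K (integer_mod_group 3)) \<and>
      card (irr_chars K (integer_mod_group 3)) = 3 \<and>
      pg_integral 2 (irr_chars K (integer_mod_group 3)) (char_prob K (integer_mod_group 3))) \<and>
     \<not> pg_isomorphic (irr_chars K (sym_group 3)) (char_prob K (sym_group 3))
         (irr_chars K (integer_mod_group 3)) (char_prob K (integer_mod_group 3)) \<and>
     (\<forall>(A :: 'a set) (p :: 'a \<Rightarrow> 'a \<Rightarrow> 'a \<Rightarrow> real).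
        prob_group A p \<and> card A = 3 \<and> pg_integral 2 A p \<longrightarrow>
          pg_isomorphic A p (irr_chars K (sym_group 3)) (char_prob K (sym_group 3)) \<or>
          pg_isomorphic A p (irr_chars K (integer_mod_group 3)) (char_prob K (integer_mod_group 3)))"
proof (intro conjI allI impI)
  note S = sym_char_prob[of K] and Z = cyclic_char_prob[of K]
  have card: "card {0, 1, 2 :: nat} = 3" by simp
  show "prob_group (irr_chars K (sym_group 3)) (char_prob K (sym_group 3))"
    "pg_integral 2 (irr_chars K (sym_group 3)) (char_prob K (sym_group 3))"
    using finite_prob_group_transport[OF S sym_prob_group finite_012] sym_prob_integral by blast+
  show "card (irr_chars K (sym_group 3)) = 3"
    using pg_isomorphic_card[OF S] card by simp
  show "prob_group (irr_chars K (integer_mod_group 3)) (char_prob K (integer_mod_group 3))"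
    "pg_integral 2 (irr_chars K (integer_mod_group 3)) (char_prob K (integer_mod_group 3))"
    using finite_prob_group_transport[OF Z cyclic_prob_group finite_012] cyclic_prob_integral by blast+
  show "card (irr_chars K (integer_mod_group 3)) = 3"
    using pg_isomorphic_card[OF Z] card by simp
  show "\<not> pg_isomorphic (irr_chars K (sym_group 3)) (char_prob K (sym_group 3))
         (irr_chars K (integer_mod_group 3)) (char_prob K (integer_mod_group 3))"
    using sym_not_iso_cyclic pg_isomorphic_trans[OF pg_isomorphic_trans[OF S] pg_isomorphic_sym[OF Z]]
    by blast
  fix A :: "'a set" and p :: "'a \<Rightarrow> 'a \<Rightarrow> 'a \<Rightarrow> real"
  assume "prob_group A p \<and> card A = 3 \<and> pg_integral 2 A p"
  then have "pg_isomorphic {0,1,2} sym_prob A p \<or> pg_isomorphic {0,1,2} cyclic_prob A p"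
    using three_element_classification by blast
  then show "pg_isomorphic A p (irr_chars K (sym_group 3)) (char_prob K (sym_group 3)) \<or>
      pg_isomorphic A p (irr_chars K (integer_mod_group 3)) (char_prob K (integer_mod_group 3))"
    using pg_isomorphic_trans[OF pg_isomorphic_sym S] pg_isomorphic_trans[OF pg_isomorphic_sym Z]
    by blast
qed

end
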